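(* For every normally traceable graph $G$, $G$ has a rayless spanning tree if and only if every end of $G$ is dominated.
   Context: All graphs may be infinite. A ray is a one-way infinite path; two rays of $G$ are equivalent if for every finite $X\subseteq V(G)$ both have a tail in the same component of $G-X$; ends are the equivalence classes. A vertex $v$ dominates a ray $R$ if there is an infinite $v$–$R$ fan in $G$ (infinitely many $v$–$R$ paths pairwise meeting only in $v$); an end is dominated if one (equivalently each) of its rays is dominated. A rayless graph is one containing no ray. A rooted tree $T\subseteq G$ is normal in $G$ if the endvertices of every $T$-path in $G$ are comparable in the tree-order of $T$. A set $U\subseteq V(G)$ is normally spanned in $G$ if it is contained in some tree $T\subseteq G$ normal in $G$. A connected graph $G$ is normally traceable if it has a tree-decomposition $(T,(V_t)_{t\in T})$ with $T$ rayless and every part $V_t$ normally spanned in $G$. *)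

theory Defs
  imports Main
begin

text \<open>Simple undirected graphs, of arbitrary cardinality.\<close>

record 'a graph =
  verts :: "'a set"
  edges :: "'a set set"

definition simple_graph :: "'a graph \<Rightarrow> bool" where
  "simple_graph G \<longleftrightarrow>
     (\<forall>e\<in>edges G. \<exists>u v. u \<in> verts G \<and> v \<in> verts G \<and> u \<noteq> v \<and> e = {u, v})"

definition subgraph :: "'a graph \<Rightarrow> 'a graph \<Rightarrow> bool" where
  "subgraph H G \<longleftrightarrow> simple_graph H \<and> verts H \<subseteq> verts G \<and> edges H \<subseteq> edges G"

definition delete_verts :: "'a graph \<Rightarrow> 'a set \<Rightarrow> 'a graph" where
  "delete_verts G X = \<lparr>verts = verts G - X, edges = {e \<in> edges G. e \<inter> X = {}}\<rparr>"

text \<open>A finite path is given by the list of its vertices, so a single vertex is a path.\<close>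

definition path :: "'a graph \<Rightarrow> 'a list \<Rightarrow> bool" where
  "path G p \<longleftrightarrow> p \<noteq> [] \<and> distinct p \<and> set p \<subseteq> verts G \<and>
     successively (\<lambda>u v. {u, v} \<in> edges G) p"

definition path_edges :: "'a list \<Rightarrow> 'a set set" where
  "path_edges p = {{p ! i, p ! Suc i} | i. Suc i < length p}"

definition path_between :: "'a graph \<Rightarrow> 'a set \<Rightarrow> 'a set \<Rightarrow> 'a list \<Rightarrow> bool" where
  "path_between G A B p \<longleftrightarrow> path G p \<and> set p \<inter> A = {hd p} \<and> set p \<inter> B = {last p}"

definition connected_graph :: "'a graph \<Rightarrow> bool" where
  "connected_graph G \<longleftrightarrow> verts G \<noteq> {} \<and>
     (\<forall>u\<in>verts G. \<forall>v\<in>verts G. \<exists>p. path G p \<and> hd p = u \<and> last p = v)"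

definition component :: "'a graph \<Rightarrow> 'a graph \<Rightarrow> bool" where
  "component G C \<longleftrightarrow> subgraph C G \<and> connected_graph C \<and>
     (\<forall>D. subgraph D G \<and> connected_graph D \<and> subgraph C D \<longrightarrow> D = C)"

text \<open>A ray is given by its vertices in order, beginning at its unique vertex of degree one.\<close>

definition ray :: "'a graph \<Rightarrow> (nat \<Rightarrow> 'a) \<Rightarrow> bool" where
  "ray G R \<longleftrightarrow> inj R \<and> range R \<subseteq> verts G \<and> (\<forall>i. {R i, R (Suc i)} \<in> edges G)"

definition rayless :: "'a graph \<Rightarrow> bool" where
  "rayless G \<longleftrightarrow> (\<nexists>R. ray G R)"

definition tail :: "(nat \<Rightarrow> 'a) \<Rightarrow> nat \<Rightarrow> (nat \<Rightarrow> 'a)" where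
  "tail R n = (\<lambda>i. R (n + i))"

definition ray_equiv :: "'a graph \<Rightarrow> ((nat \<Rightarrow> 'a) \<times> (nat \<Rightarrow> 'a)) set" where
  "ray_equiv G = {(R, S). ray G R \<and> ray G S \<and>
     (\<forall>X. finite X \<and> X \<subseteq> verts G \<longrightarrow>
       (\<exists>C m n. component (delete_verts G X) C \<and> ray C (tail R m) \<and> ray C (tail S n)))}"

definition ends :: "'a graph \<Rightarrow> (nat \<Rightarrow> 'a) set set" where
  "ends G = {R. ray G R} // ray_equiv G"

definition fan :: "'a graph \<Rightarrow> 'a \<Rightarrow> 'a set \<Rightarrow> 'a list set \<Rightarrow> bool" where
  "fan G v B P \<longleftrightarrow> (\<forall>p\<in>P. path_between G {v} B p) \<and>
     (\<forall>p\<in>P. \<forall>q\<in>P. p \<noteq> q \<longrightarrow> set p \<inter> set q = {v})"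

text \<open>If \<open>v\<close> lies on the ray, then the only path from \<open>v\<close> to the ray meeting it exactly once is
  trivial. The fan therefore ends in the ray minus \<open>v\<close>, so that whether \<open>v\<close> dominates
  a ray depends only on its end.\<close>

definition dominates :: "'a graph \<Rightarrow> 'a \<Rightarrow> (nat \<Rightarrow> 'a) \<Rightarrow> bool" where
  "dominates G v R \<longleftrightarrow> (\<exists>P. infinite P \<and> fan G v (range R - {v}) P)"

definition dominated_end :: "'a graph \<Rightarrow> (nat \<Rightarrow> 'a) set \<Rightarrow> bool" where
  "dominated_end G \<omega> \<longleftrightarrow> (\<exists>R\<in>\<omega>. \<exists>v\<in>verts G. dominates G v R)"

definition cycle :: "'a graph \<Rightarrow> 'a list \<Rightarrow> bool" where
  "cycle G c \<longleftrightarrow> path G c \<and> 3 \<le> length c \<and> {last c, hd c} \<in> edges G"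

definition tree :: "'a graph \<Rightarrow> bool" where
  "tree T \<longleftrightarrow> simple_graph T \<and> connected_graph T \<and> (\<nexists>c. cycle T c)"

definition spanning_tree :: "'a graph \<Rightarrow> 'a graph \<Rightarrow> bool" where
  "spanning_tree G T \<longleftrightarrow> tree T \<and> subgraph T G \<and> verts T = verts G"

text \<open>The tree-order of \<open>T\<close> with root \<open>r\<close>: \<open>x\<close> lies below \<open>y\<close> iff it lies on the path in \<open>T\<close>
  from \<open>r\<close> to \<open>y\<close>.\<close>

definition tree_le :: "'a graph \<Rightarrow> 'a \<Rightarrow> 'a \<Rightarrow> 'a \<Rightarrow> bool" where
  "tree_le T r x y \<longleftrightarrow> (\<exists>p. path T p \<and> hd p = r \<and> last p = y \<and> x \<in> set p)"

text \<open>A path of \<open>G\<close> with at least one edge whose intersection with \<open>H\<close> consists of its two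
  endvertices (and no edge).\<close>

definition H_path :: "'a graph \<Rightarrow> 'a graph \<Rightarrow> 'a list \<Rightarrow> bool" where
  "H_path G H p \<longleftrightarrow> path G p \<and> 2 \<le> length p \<and>
     set p \<inter> verts H = {hd p, last p} \<and> path_edges p \<inter> edges H = {}"

definition normal_tree :: "'a graph \<Rightarrow> 'a graph \<Rightarrow> 'a \<Rightarrow> bool" where
  "normal_tree G T r \<longleftrightarrow> tree T \<and> subgraph T G \<and> r \<in> verts T \<and>
     (\<forall>p. H_path G T p \<longrightarrow> tree_le T r (hd p) (last p) \<or> tree_le T r (last p) (hd p))"

definition normally_spanned :: "'a graph \<Rightarrow> 'a set \<Rightarrow> bool" where
  "normally_spanned G U \<longleftrightarrow> (\<exists>T r. normal_tree G T r \<and> U \<subseteq> verts T)"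

definition tree_decomposition :: "'a graph \<Rightarrow> 'b graph \<Rightarrow> ('b \<Rightarrow> 'a set) \<Rightarrow> bool" where
  "tree_decomposition G T V \<longleftrightarrow> tree T \<and>
     (\<Union>t\<in>verts T. V t) = verts G \<and>
     (\<forall>e\<in>edges G. \<exists>t\<in>verts T. e \<subseteq> V t) \<and>
     (\<forall>p. path T p \<longrightarrow> (\<forall>t\<in>set p. V (hd p) \<inter> V (last p) \<subseteq> V t))"

text \<open>HOL cannot quantify existentially over the type of the nodes of the decomposition tree, so
  that type is a parameter. As a hypothesis of a theorem that is polymorphic in \<open>'b\<close>, the
  predicate covers decomposition trees of every size.\<close>

definition normally_traceable :: "'b itself \<Rightarrow> 'a graph \<Rightarrow> bool" where
  "normally_traceable _ G \<longleftrightarrow> connected_graph G \<and>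
     (\<exists>(T :: 'b graph) V. tree_decomposition G T V \<and> rayless T \<and>
        (\<forall>t\<in>verts T. normally_spanned G (V t)))"

end

theory Submission
  imports Defs "HOL-Library.Sublist"
begin

text \<open>A rayless spanning tree contains, by the star-comb dichotomy, an infinite fan to every ray of
  \<open>G\<close>, which gives one direction.

  Conversely, let all ends be dominated. Every normally spanned set is an increasing union of tame
  sets, the levels of a normal tree. To extend a given vertex set \<open>A\<close> by a rayless forest
  covering such a union, add finite connected sets stage by stage inside the components of the
  rest, always attached to a neighbour of the component that was added as early as possible. If a
  ray \<open>R\<close> ascended in the resulting forest, the components \<open>C\<^sub>0 \<supseteq> C\<^sub>1 \<supseteq> \<dots>\<close> of the successive rests
  that contain tails of \<open>R\<close> would have neighbourhoods that are eventually finite and eventually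
  avoid any given vertex. As \<open>G\<close> is connected, \<open>\<Inter>n. C\<^sub>n\<close> is then empty, so every vertex is separated
  from \<open>R\<close> by some finite neighbourhood of \<open>C\<^sub>n\<close> and cannot dominate \<open>R\<close>.

  Applying this first to the part at the root of the decomposition tree, and then recursively in
  the components of the rest, each of which lies above a single child, covers \<open>G\<close>; the
  recursion is well-founded since the decomposition tree is rayless.\<close>

section \<open>Components and rayless rooted forests\<close>

locale ugraph =
  fixes V :: "'a set" and adj :: "'a \<Rightarrow> 'a \<Rightarrow> bool"
  assumes adj_sym: "adj x y \<Longrightarrow> adj y x"
    and adj_in: "adj x y \<Longrightarrow> x \<in> V"
begin

lemma adj_in2: "adj x y \<Longrightarrow> y \<in> V"
  using adj_sym adj_in by blast

section \<open>Walks inside a vertex set, connectedness and components\<close>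

definition reach :: "'a set \<Rightarrow> 'a \<Rightarrow> 'a \<Rightarrow> bool" where
  "reach S = (\<lambda>u v. u \<in> S \<and> v \<in> S \<and> adj u v)\<^sup>*\<^sup>*"

definition conn :: "'a set \<Rightarrow> bool" where
  "conn S \<longleftrightarrow> (\<forall>x\<in>S. \<forall>y\<in>S. reach S x y)"

definition nbhd :: "'a set \<Rightarrow> 'a set" where
  "nbhd C = {y. y \<notin> C \<and> (\<exists>x\<in>C. adj x y)}"

definition is_comp :: "'a set \<Rightarrow> 'a set \<Rightarrow> bool" where
  "is_comp S C \<longleftrightarrow> C \<noteq> {} \<and> C \<subseteq> S \<and> conn C \<and> (\<forall>x\<in>C. \<forall>y\<in>S. adj x y \<longrightarrow> y \<in> C)"

lemma reach_refl [simp]: "reach S x x"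
  by (simp add: reach_def)

lemma reach_trans: "reach S x y \<Longrightarrow> reach S y z \<Longrightarrow> reach S x z"
  by (simp add: reach_def)

lemma reach_edge: "x \<in> S \<Longrightarrow> y \<in> S \<Longrightarrow> adj x y \<Longrightarrow> reach S x y"
  by (auto simp: reach_def)

lemma reach_sym: "reach S x y \<Longrightarrow> reach S y x"
  unfolding reach_def
  by (rule sympD[OF symp_rtranclp]) (auto intro: sympI adj_sym)

lemma reach_mono: "reach S x y \<Longrightarrow> S \<subseteq> S' \<Longrightarrow> reach S' x y"
  unfolding reach_def by (rule rtranclp_mono[THEN predicate2D]) auto

text \<open>Induction along a walk in the form of an invariant set \<open>D\<close>. The later
  arguments that confine a connected set to one side of a separator all use it.\<close>

lemma reach_closed:
  assumes "reach S x y" "x \<in> D" "\<And>u v. u \<in> D \<Longrightarrow> u \<in> S \<Longrightarrow> v \<in> S \<Longrightarrow> adj u v \<Longrightarrow> v \<in> D"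
  shows "y \<in> D"
  using assms(1,2) unfolding reach_def
  by (induction rule: rtranclp_induct) (auto intro: assms(3))

lemma reach_in: "reach S x y \<Longrightarrow> x \<in> S \<Longrightarrow> y \<in> S"
  by (rule reach_closed)

text \<open>Every vertex on a walk from \<open>x\<close> is itself reachable from \<open>x\<close>;
  hence a reachability class is connected within itself, not merely within \<open>S\<close>.\<close>

lemma reach_in_component:
  assumes "reach S x y"
  shows "reach {z. reach S x z} x y"
  using assms unfolding reach_def
proof (induction rule: rtranclp_induct)
  case (step y z)
  then show ?case
    by (smt (verit, best) mem_Collect_eq rtranclp.rtrancl_into_rtrancl)
qed auto

text \<open>Loop erasure: when the walk returns to a vertex already listed, the list is cut back to
  that vertex.\<close>

lemma reach_list:
  assumes "reach S a b" "a \<in> S"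
  shows "\<exists>p. p \<noteq> [] \<and> distinct p \<and> set p \<subseteq> S \<and> successively adj p \<and> hd p = a \<and> last p = b"
  using assms(1) unfolding reach_def
proof (induction rule: rtranclp_induct)
  case base
  then show ?case using assms(2) by (intro exI[of _ "[a]"]) simp
next
  case (step y z)
  then obtain p where p: "p \<noteq> []" "distinct p" "set p \<subseteq> S" "successively adj p" "hd p = a" "last p = y"
    by blast
  show ?case
  proof (cases "z \<in> set p")
    case True
    then obtain p1 p2 where "p = p1 @ z # p2" by (meson split_list)
    then show ?thesis using p
      by (intro exI[of _ "p1 @ [z]"]) (auto simp: successively_append_iff hd_append split: if_splits)
  next
    case False
    then show ?thesis using p step
      by (intro exI[of _ "p @ [z]"]) (auto simp: successively_append_iff)
  qed
qed

lemma list_reach: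
  assumes "successively adj p" "set p \<subseteq> S" "p \<noteq> []"
  shows "reach S (hd p) (last p)"
  using assms
proof (induction p)
  case (Cons a p)
  show ?case
  proof (cases "p = []")
    case False
    then have "reach S a (hd p)" using Cons.prems by (intro reach_edge) (auto simp: successively_Cons)
    then show ?thesis using Cons False by (auto simp: successively_Cons intro: reach_trans)
  qed simp
qed simp

lemma comp_of:
  assumes "x \<in> S"
  shows "is_comp S {z. reach S x z}"
  unfolding is_comp_def conn_def
proof (intro conjI ballI impI)
  show "{z. reach S x z} \<subseteq> S" using assms reach_in by auto
  show "reach {z. reach S x z} u v" if "u \<in> {z. reach S x z}" "v \<in> {z. reach S x z}" for u v
    using that by (auto intro: reach_trans[OF reach_sym] reach_in_component)
  show "y \<in> {z. reach S x z}" if "u \<in> {z. reach S x z}" "y \<in> S" "adj u y" for u y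
    using that assms by (auto intro: reach_trans reach_edge reach_in)
qed (auto intro: exI[of _ x])

lemma exists_comp:
  assumes "x \<in> S"
  obtains C where "is_comp S C" "x \<in> C"
  using comp_of[OF assms] by auto

lemma comp_reach: "is_comp S C \<Longrightarrow> x \<in> C \<Longrightarrow> reach S x y \<Longrightarrow> y \<in> C"
  by (erule reach_closed) (auto simp: is_comp_def)

lemma conn_subset_comp:
  assumes "is_comp S C" "conn W" "W \<subseteq> S" "x \<in> W" "x \<in> C"
  shows "W \<subseteq> C"
  using assms by (auto simp: conn_def intro: comp_reach reach_mono)

lemma comp_eq:
  assumes "is_comp S C" "is_comp S D" "x \<in> C" "x \<in> D"
  shows "C = D"
proof
  show "C \<subseteq> D" using assms by (intro conn_subset_comp[of S D C x]) (auto simp: is_comp_def)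
  show "D \<subseteq> C" using assms by (intro conn_subset_comp[of S C D x]) (auto simp: is_comp_def)
qed

lemma comp_nbhd: "is_comp S C \<Longrightarrow> nbhd C \<inter> S = {}"
  by (auto simp: is_comp_def nbhd_def)

lemma conn_edge:
  assumes "conn S" "x \<in> S" "x \<in> D" "y \<in> S" "y \<notin> D"
  obtains u v where "u \<in> S" "v \<in> S" "u \<in> D" "v \<notin> D" "adj u v"
  using assms reach_closed[of S x y D] unfolding conn_def by blast

lemma conn_insert:
  assumes "conn F" "x \<in> F" "adj x y"
  shows "conn (insert y F)"
proof -
  have *: "reach (insert y F) x z" if "z \<in> insert y F" for z
    using that assms by (auto simp: conn_def intro: reach_edge reach_mono)
  then show ?thesis unfolding conn_def by (meson reach_sym reach_trans)
qed

text \<open>Fix \<open>a\<close> in \<open>F m\<close>; by induction on \<open>i\<close>, all of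
  \<open>F i\<close> is reachable from \<open>a\<close>, crossing from one set to the next by the
  given edge.\<close>

lemma conn_chain_union:
  assumes F: "\<And>i. i \<ge> m \<Longrightarrow> conn (F i)"
    and adj: "\<And>i. i \<ge> m \<Longrightarrow> \<exists>x\<in>F i. \<exists>y\<in>F (Suc i). adj x y"
  shows "conn (\<Union>i\<in>{m..}. F i)"
proof -
  let ?W = "\<Union>i\<in>{m..}. F i"
  obtain a where a: "a \<in> F m" using adj by blast
  have "\<forall>y\<in>F i. reach ?W a y" if "i \<ge> m" for i
    using that
  proof (induction rule: dec_induct)
    case base
    then show ?case using F[of m] a by (auto simp: conn_def intro: reach_mono[of "F m"])
  next
    case (step i)
    obtain x y where xy: "x \<in> F i" "y \<in> F (Suc i)" "adj x y" using adj step by blast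
    have "reach ?W x y" using xy step by (intro reach_edge) auto
    then have "reach ?W a y" using step.IH xy by (blast intro: reach_trans)
    moreover have "reach ?W y z" if "z \<in> F (Suc i)" for z
    proof (rule reach_mono)
      show "reach (F (Suc i)) y z" using F[of "Suc i"] step.hyps that xy by (simp add: conn_def)
      show "F (Suc i) \<subseteq> ?W" using step.hyps by (intro UN_upper) simp
    qed
    ultimately show ?case by (blast intro: reach_trans)
  qed
  then show ?thesis unfolding conn_def by (auto intro: reach_trans[OF reach_sym])
qed

text \<open>A forest on \<open>B\<close> rooted in \<open>A\<close> is encoded by its parent map. The two chain conditions say
  that every vertex has finitely many ancestors and that no ray ascends.\<close>

definition rforest :: "'a set \<Rightarrow> 'a set \<Rightarrow> ('a \<Rightarrow> 'a) \<Rightarrow> bool" where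
  "rforest A B p \<longleftrightarrow> A \<inter> B = {} \<and> (\<forall>x\<in>B. p x \<in> A \<union> B \<and> adj x (p x)) \<and>
     (\<nexists>f. \<forall>i::nat. f i \<in> B \<and> f (Suc i) = p (f i)) \<and>
     (\<nexists>f. \<forall>i::nat. f (Suc i) \<in> B \<and> p (f (Suc i)) = f i)"

lemma rforestD:
  assumes "rforest A B p"
  shows "A \<inter> B = {}" "x \<in> B \<Longrightarrow> p x \<in> A \<union> B" "x \<in> B \<Longrightarrow> adj x (p x)"
    "\<not> (\<forall>i::nat. f i \<in> B \<and> f (Suc i) = p (f i))"
    "\<not> (\<forall>i::nat. f (Suc i) \<in> B \<and> p (f (Suc i)) = f i)"
  using assms unfolding rforest_def by auto

lemma rforest_cong:
  assumes "rforest A B p" "\<And>x. x \<in> B \<Longrightarrow> p x = q x"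
  shows "rforest A B q"
proof -
  have 1: "(f (Suc i) \<in> B \<and> q (f (Suc i)) = f i) = (f (Suc i) \<in> B \<and> p (f (Suc i)) = f i)" for f and i::nat
    using assms(2) by auto
  have 2: "(f i \<in> B \<and> f (Suc i) = q (f i)) = (f i \<in> B \<and> f (Suc i) = p (f i))" for f and i::nat
    using assms(2) by auto
  show ?thesis using assms unfolding rforest_def 1 2 by auto
qed

lemma rforest_base:
  assumes "rforest {v} F q" "v \<in> B" "B \<inter> F = {}"
  shows "rforest B F q"
proof -
  have "q x \<in> B \<union> F" if "x \<in> F" for x
    using rforestD(2)[OF assms(1) that] assms(2) by auto
  then show ?thesis using assms(1,3) unfolding rforest_def by simp
qed

lemma rforest_singleton:
  assumes "adj x y" "y \<in> A" "x \<notin> A"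
  shows "rforest A {x} (\<lambda>_. y)"
proof -
  have "\<not> (\<forall>i. f i \<in> {x} \<and> f (Suc i) = y)" "\<not> (\<forall>i. f (Suc i) \<in> {x} \<and> y = f i)"
    for f :: "nat \<Rightarrow> 'a"
    using assms by (metis singletonD)+
  then show ?thesis using assms unfolding rforest_def by simp
qed

text \<open>Stacks a second forest on the first. A chain of parents that enters \<open>B\<close>
  stays in \<open>B\<close>, because it never visits \<open>A\<close>; a chain of children that
  enters \<open>C\<close> stays in \<open>C\<close>, because parents of vertices of \<open>B\<close>
  lie in \<open>A \<union> B\<close>. So a bad chain has a tail in a single layer.\<close>

lemma rforest_Un:
  assumes 1: "rforest A B p" and 2: "rforest (A \<union> B) C q"
  shows "rforest A (B \<union> C) (\<lambda>x. if x \<in> B then p x else q x)" (is "rforest A _ ?r")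
proof -
  have disj: "A \<inter> B = {}" "(A \<union> B) \<inter> C = {}"
    using assms by (auto dest: rforestD(1))
  have r: "x \<in> B \<Longrightarrow> ?r x = p x" "x \<in> C \<Longrightarrow> ?r x = q x" for x
    using disj by auto
  have down: False if f: "\<And>i::nat. f i \<in> B \<union> C \<and> f (Suc i) = ?r (f i)" for f
  proof (cases "\<exists>n. f n \<in> B")
    case True
    then obtain n where n: "f n \<in> B" by blast
    have "f (n + i) \<in> B" for i
    proof (induction i)
      case (Suc i)
      have "f (Suc (n + i)) = p (f (n + i))" using Suc f r by metis
      then have "f (Suc (n + i)) \<in> A \<union> B" using rforestD(2)[OF 1 Suc] by simp
      then show ?case using f[of "Suc (n + i)"] disj by auto
    qed (simp add: n)
    then have "\<forall>i. f (n + i) \<in> B \<and> f (n + Suc i) = p (f (n + i))"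
      using f r by (metis add_Suc_right)
    then show False using rforestD(4)[OF 1, of "\<lambda>i. f (n + i)"] by simp
  next
    case False
    then have "\<forall>i. f i \<in> C \<and> f (Suc i) = q (f i)" using f r by (metis UnE)
    then show False using rforestD(4)[OF 2] by blast
  qed
  have up: False if f: "\<And>i::nat. f (Suc i) \<in> B \<union> C \<and> ?r (f (Suc i)) = f i" for f
  proof (cases "\<exists>n. f (Suc n) \<in> C")
    case True
    then obtain n where n: "f (Suc n) \<in> C" by blast
    have "f (Suc n + i) \<in> C" for i
    proof (induction i)
      case (Suc i)
      show ?case
      proof (rule ccontr)
        assume "f (Suc n + Suc i) \<notin> C"
        then have B: "f (Suc (Suc n + i)) \<in> B" using f[of "Suc n + i"] by auto
        then have "f (Suc n + i) = p (f (Suc (Suc n + i)))" using f r by metis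
        then have "f (Suc n + i) \<in> A \<union> B" using rforestD(2)[OF 1 B] by simp
        then show False using Suc disj by auto
      qed
    qed (use n in simp)
    then have C: "f (Suc n + Suc i) \<in> C" for i by blast
    have "\<forall>i. f (Suc n + Suc i) \<in> C \<and> q (f (Suc n + Suc i)) = f (Suc n + i)"
      using C f r by (metis add_Suc_right)
    then show False using rforestD(5)[OF 2, of "\<lambda>i. f (Suc n + i)"] by simp
  next
    case False
    then have "\<forall>i. f (Suc i) \<in> B \<and> p (f (Suc i)) = f i" using f r by (metis UnE)
    then show False using rforestD(5)[OF 1] by blast
  qed
  have "?r x \<in> A \<union> (B \<union> C) \<and> adj x (?r x)" if "x \<in> B \<union> C" for x
    using that r rforestD(2,3)[OF 1] rforestD(2,3)[OF 2] by auto
  then show ?thesis using down up disj unfolding rforest_def by blast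
qed

text \<open>Side by side, forests over the same \<open>A\<close> do not interact: a parent lies in
  \<open>A\<close> or in the same \<open>F C\<close>, so no chain changes its index.
  \<open>Q\<close> carries further properties of the chosen maps along and must depend only on their
  values on \<open>F C\<close>.\<close>

lemma rforest_UN:
  assumes F: "\<And>C. C \<in> I \<Longrightarrow> \<exists>p. rforest A (F C) p \<and> Q C p"
    and disj: "\<And>C D x. C \<in> I \<Longrightarrow> D \<in> I \<Longrightarrow> x \<in> F C \<Longrightarrow> x \<in> F D \<Longrightarrow> C = D"
    and Q: "\<And>C p q. C \<in> I \<Longrightarrow> Q C p \<Longrightarrow> (\<And>x. x \<in> F C \<Longrightarrow> q x = p x) \<Longrightarrow> Q C q"
  obtains p where "rforest A (\<Union>C\<in>I. F C) p" "\<And>C. C \<in> I \<Longrightarrow> Q C p"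
proof -
  obtain ps where ps: "\<And>C. C \<in> I \<Longrightarrow> rforest A (F C) (ps C) \<and> Q C (ps C)"
    using F by metis
  define p where "p x = ps (THE C. C \<in> I \<and> x \<in> F C) x" for x
  have p: "p x = ps C x" if "C \<in> I" "x \<in> F C" for C x
  proof -
    have "(THE C. C \<in> I \<and> x \<in> F C) = C" using that disj by blast
    then show ?thesis by (simp add: p_def)
  qed
  have rf: "rforest A (F C) p" if "C \<in> I" for C
    using rforest_cong[of A "F C" "ps C" p] ps p that by simp
  let ?B = "\<Union>C\<in>I. F C"
  have A: "A \<inter> ?B = {}" using rf rforestD(1) by blast
  have stay: "C = D" if "C \<in> I" "D \<in> I" "x \<in> F C" "p x \<in> F D" for x C D
    using that rforestD(1,2)[OF rf] disj[of C D "p x"] A by blast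
  have down: False if f: "\<And>i::nat. f i \<in> ?B \<and> f (Suc i) = p (f i)" for f
  proof -
    obtain C where C: "C \<in> I" "f 0 \<in> F C" using f by blast
    have "f i \<in> F C" for i
    proof (induction i)
      case (Suc i)
      obtain D where D: "D \<in> I" "f (Suc i) \<in> F D" using f[of "Suc i"] by blast
      then have "C = D" using stay[OF C(1) D(1) Suc] f[of i] by simp
      then show ?case using D by simp
    qed (use C in simp)
    then show False using rforestD(4)[OF rf[OF C(1)], of f] f by blast
  qed
  have up: False if f: "\<And>i::nat. f (Suc i) \<in> ?B \<and> p (f (Suc i)) = f i" for f
  proof -
    obtain C where C: "C \<in> I" "f (Suc 0) \<in> F C" using f by blast
    have "f (Suc i) \<in> F C" for i
    proof (induction i)
      case (Suc i)
      obtain D where D: "D \<in> I" "f (Suc (Suc i)) \<in> F D" using f[of "Suc i"] by blast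
      then have "D = C" using stay[OF D(1) C(1) D(2)] Suc f[of "Suc i"] by simp
      then show ?case using D by simp
    qed (use C in simp)
    then show False using rforestD(5)[OF rf[OF C(1)], of f] f by blast
  qed
  have "p x \<in> A \<union> ?B \<and> adj x (p x)" if "x \<in> ?B" for x
    using that rforestD(2,3)[OF rf] by blast
  then have "rforest A ?B p" unfolding rforest_def using A up down by blast
  moreover have "Q C p" if "C \<in> I" for C
    using Q ps[OF that] p that by blast
  ultimately show ?thesis using that by blast
qed

lemma rforest_components:
  assumes "\<And>C. is_comp S C \<Longrightarrow> \<exists>p. rforest A C p"
  shows "\<exists>p. rforest A S p"
proof -
  obtain p where p: "rforest A (\<Union>C\<in>{C. is_comp S C}. C) p"
    by (rule rforest_UN[of "{C. is_comp S C}" A "\<lambda>C. C" "\<lambda>_ _. True"])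
      (use assms in \<open>auto dest: comp_eq\<close>)
  have "(\<Union>C\<in>{C. is_comp S C}. C) = S"
  proof
    show "(\<Union>C\<in>{C. is_comp S C}. C) \<subseteq> S" unfolding is_comp_def by blast
    show "S \<subseteq> (\<Union>C\<in>{C. is_comp S C}. C)"
    proof
      fix x assume "x \<in> S"
      then obtain C where "is_comp S C" "x \<in> C" by (rule exists_comp)
      then show "x \<in> (\<Union>C\<in>{C. is_comp S C}. C)" by blast
    qed
  qed
  with p show ?thesis by auto
qed

text \<open>An edge from \<open>C\<close> to a parent outside \<open>C\<close> ends in
  \<open>nbhd C\<close>, hence in \<open>A\<close>.\<close>

lemma rforest_Int:
  assumes "rforest A B p" "nbhd C \<subseteq> A"
  shows "rforest A (B \<inter> C) p"
proof -
  have "p x \<in> A \<union> B \<inter> C \<and> adj x (p x)" if "x \<in> B \<inter> C" for x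
    using that rforestD(1-3)[OF assms(1)] assms(2) unfolding nbhd_def by blast
  moreover have "\<not> (\<forall>i::nat. f i \<in> B \<inter> C \<and> f (Suc i) = p (f i))"
    "\<not> (\<forall>i::nat. f (Suc i) \<in> B \<inter> C \<and> p (f (Suc i)) = f i)" for f
    using rforestD(4,5)[OF assms(1), of f] by auto
  ultimately show ?thesis using rforestD(1)[OF assms(1)] unfolding rforest_def by blast
qed

section \<open>Covering a union of tame sets\<close>

text \<open>The sequences excluded here are those in which a comb with all its teeth in \<open>U\<close> can be
  found, so tame sets are the dispersed sets of Jung.\<close>

definition tame :: "'a set \<Rightarrow> bool" where
  "tame U \<longleftrightarrow> \<not> (\<exists>F::nat \<Rightarrow> 'a set.
     (\<forall>m. conn (F m) \<and> F m \<subseteq> V \<and> F m \<inter> U \<noteq> {} \<and> (\<exists>x\<in>F m. \<exists>y\<in>F (Suc m). adj x y)) \<and>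
     (\<forall>m n. m \<noteq> n \<longrightarrow> F m \<inter> F n = {}))"

lemma tame_subset:
  assumes "tame U" "U' \<subseteq> U"
  shows "tame U'"
  unfolding tame_def
proof (rule notI, elim exE)
  fix F :: "nat \<Rightarrow> 'a set"
  assume F: "(\<forall>m. conn (F m) \<and> F m \<subseteq> V \<and> F m \<inter> U' \<noteq> {} \<and> (\<exists>x\<in>F m. \<exists>y\<in>F (Suc m). adj x y)) \<and>
     (\<forall>m n. m \<noteq> n \<longrightarrow> F m \<inter> F n = {})"
  have "F m \<inter> U \<noteq> {}" for m
    using F assms(2) by (meson disjoint_iff subsetD)
  with F have "\<not> tame U" unfolding tame_def not_not by (intro exI[of _ F]) simp
  then show False using assms(1) by contradiction
qed

section \<open>Neighbourhoods of components, and growing a finite forest inside one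
  component\<close>

lemma nbhd_in: "nbhd C \<subseteq> V"
  by (auto simp: nbhd_def intro: adj_in2)

lemma comp_nbhd_subset: "is_comp (V - B) C \<Longrightarrow> nbhd C \<subseteq> B"
  using comp_nbhd[of "V - B" C] nbhd_in[of C] by blast

lemma conn_nbhd_nonempty:
  assumes "conn V" "x \<in> C" "C \<subseteq> V" "y \<in> V" "y \<notin> C"
  shows "nbhd C \<noteq> {}"
proof -
  have "x \<in> V" using assms by blast
  with assms obtain u v where "u \<in> C" "v \<notin> C" "adj u v"
    using conn_edge[of V x C y] by metis
  then show ?thesis by (auto simp: nbhd_def)
qed

text \<open>Along a walk from \<open>x\<close> to \<open>w\<close>, each new vertex becomes a leaf
  whose parent is its predecessor on the walk.\<close>

lemma rforest_grow:
  assumes "reach C x w" "x \<in> C" "v \<notin> C"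
    and "finite F" "F \<subseteq> C" "x \<in> F" "conn F" "rforest {v} F q"
  shows "\<exists>F' q'. finite F' \<and> F' \<subseteq> C \<and> conn F' \<and> rforest {v} F' q' \<and> F \<subseteq> F' \<and> w \<in> F'"
  using assms(1) unfolding reach_def
proof (induction rule: rtranclp_induct)
  case base
  then show ?case using assms by blast
next
  case (step y z)
  then obtain F' q' where F': "finite F'" "F' \<subseteq> C" "conn F'" "rforest {v} F' q'" "F \<subseteq> F'" "y \<in> F'"
    by blast
  show ?case
  proof (cases "z \<in> F'")
    case False
    have "rforest ({v} \<union> F') {z} (\<lambda>_. y)"
      using F' step assms(3) False by (intro rforest_singleton) (auto intro: adj_sym)
    from rforest_Un[OF F'(4) this] have "\<exists>q. rforest {v} (insert z F') q"
      by auto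
    moreover have "conn (insert z F')" using conn_insert[OF F'(3,6)] step by blast
    ultimately show ?thesis using F' step by (meson finite_insert insertI1 insert_subset subset_insertI2)
  qed (use F' in blast)
qed

text \<open>Starting at a vertex \<open>x\<close> attached to a neighbour \<open>v\<close> of least
  label, \<open>rforest_grow\<close> is applied twice: to reach the first \<open>U k\<close> that
  \<open>C\<close> meets, and to reach a vertex next to a neighbour with label \<open>n\<close>. As
  \<open>U\<close> increases, the first \<open>U k\<close> settles all later ones. Since
  \<open>v\<close> is the only root, a parent outside \<open>F\<close> can only be
  \<open>v\<close>.\<close>

lemma component_step:
  fixes U :: "nat \<Rightarrow> 'a set" and l :: "'a \<Rightarrow> nat"
  assumes C: "is_comp (V - B) C" and nb: "nbhd C \<noteq> {}"
    and U: "mono U" and CU: "C \<inter> (\<Union>k. U k) \<noteq> {}"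
  obtains F q where "finite F" "F \<subseteq> C" "conn F" "\<And>k. C \<inter> U k \<noteq> {} \<Longrightarrow> F \<inter> U k \<noteq> {}"
    "(\<exists>z\<in>nbhd C. l z = n) \<Longrightarrow> (\<exists>z\<in>nbhd C. l z = n \<and> (\<exists>y\<in>F. adj y z))"
    "rforest B F q" "\<And>x. x \<in> F \<Longrightarrow> q x \<notin> F \<Longrightarrow> \<forall>z\<in>nbhd C. l (q x) \<le> l z"
proof -
  have Cc: "conn C" and CB: "B \<inter> C = {}" using C by (auto simp: is_comp_def)
  define v where "v = arg_min l (\<lambda>z. z \<in> nbhd C)"
  obtain z0 where "z0 \<in> nbhd C" using nb by blast
  then have v: "v \<in> nbhd C" "\<forall>z\<in>nbhd C. l v \<le> l z"
    using arg_min_nat_lemma[of "\<lambda>z. z \<in> nbhd C" z0 l] unfolding v_def by auto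
  then obtain x where x: "x \<in> C" "adj x v" "v \<notin> C" by (auto simp: nbhd_def)
  define k where "k = (LEAST k. C \<inter> U k \<noteq> {})"
  have "\<exists>k. C \<inter> U k \<noteq> {}" using CU by blast
  then have k: "C \<inter> U k \<noteq> {}" "\<And>j. C \<inter> U j \<noteq> {} \<Longrightarrow> k \<le> j"
    unfolding k_def by (rule LeastI_ex) (rule Least_le)
  then obtain u where u: "u \<in> C" "u \<in> U k" by blast
  have "rforest {v} {x} (\<lambda>_. v)" using x by (intro rforest_singleton) auto
  moreover have "conn {x}" by (simp add: conn_def)
  moreover have "reach C x u" using Cc x u by (simp add: conn_def)
  ultimately obtain F1 q1 where F1: "finite F1" "F1 \<subseteq> C" "conn F1" "rforest {v} F1 q1" "x \<in> F1" "u \<in> F1"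
    using rforest_grow[of C x u v "{x}" "\<lambda>_. v"] x by auto
  \<comment> \<open>If no neighbour of \<open>C\<close> has label \<open>n\<close>, then
    \<open>y\<close> is just \<open>x\<close>.\<close>
  obtain y where y: "y \<in> C" "(\<exists>z\<in>nbhd C. l z = n) \<Longrightarrow> (\<exists>z\<in>nbhd C. l z = n \<and> adj y z)"
  proof (cases "\<exists>z\<in>nbhd C. l z = n")
    case True
    then obtain z where "z \<in> nbhd C" "l z = n" by blast
    moreover from this obtain y where "y \<in> C" "adj y z" by (auto simp: nbhd_def)
    ultimately show ?thesis using that by blast
  qed (use that x in blast)
  have "reach C x y" using Cc x y by (simp add: conn_def)
  then obtain F q where F: "finite F" "F \<subseteq> C" "conn F" "rforest {v} F q" "F1 \<subseteq> F" "y \<in> F"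
    using rforest_grow[of C x y v F1 q1] x F1 by blast
  show ?thesis
  proof
    show "F \<inter> U j \<noteq> {}" if "C \<inter> U j \<noteq> {}" for j
      using k(2)[OF that] monoD[OF U, of k j] u F1 F by blast
    show "\<exists>z\<in>nbhd C. l z = n \<and> (\<exists>y\<in>F. adj y z)" if "\<exists>z\<in>nbhd C. l z = n"
      using y(2)[OF that] F by blast
    show "rforest B F q"
      using comp_nbhd_subset[OF C] v F CB by (intro rforest_base[OF F(4)]) auto
    show "\<forall>z\<in>nbhd C. l (q x) \<le> l z" if "x \<in> F" "q x \<notin> F" for x
      using rforestD(2)[OF F(4) that(1)] that v by simp
  qed (use F in auto)
qed

text \<open>\<open>B\<close> is the set of vertices reached after \<open>n\<close> stages, \<open>l\<close> records the stage at which a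
  vertex was added, and \<open>p\<close> is the parent map. In each component \<open>C\<close> of the rest that still meets
  \<open>\<Union>k. U k\<close>, a stage adds a finite connected set. It meets the first possible \<open>U k\<close> and touches
  the newest neighbours of \<open>C\<close>, so that a vertex never reached would yield a comb; and it is
  attached to an oldest neighbour of \<open>C\<close>, so that an ascending ray can only arise if every vertex
  eventually leaves the neighbourhoods of the components along it.\<close>

definition stage_inv :: "'a set \<Rightarrow> nat \<Rightarrow> 'a set \<Rightarrow> ('a \<Rightarrow> nat) \<Rightarrow> ('a \<Rightarrow> 'a) \<Rightarrow> bool" where
  "stage_inv A n B l p \<longleftrightarrow> A \<subseteq> B \<and> B \<subseteq> V \<and> (\<forall>x\<in>B. l x \<le> n \<and> (l x = 0 \<longleftrightarrow> x \<in> A)) \<and>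
     rforest A (B - A) p \<and> (\<forall>C. is_comp (V - B) C \<longrightarrow> finite (nbhd C - A))"

definition stage_step :: "(nat \<Rightarrow> 'a set) \<Rightarrow> 'a set \<Rightarrow> nat \<Rightarrow> 'a set \<Rightarrow> ('a \<Rightarrow> nat) \<Rightarrow> ('a \<Rightarrow> 'a) \<Rightarrow>
    'a set \<Rightarrow> ('a \<Rightarrow> nat) \<Rightarrow> ('a \<Rightarrow> 'a) \<Rightarrow> bool" where
  "stage_step U A n B l p B' l' p' \<longleftrightarrow> B \<subseteq> B' \<and> (\<forall>x\<in>B. l' x = l x) \<and> (\<forall>x\<in>B-A. p' x = p x) \<and>
     (\<forall>x\<in>B'-B. l' x = Suc n) \<and>
     (\<forall>C. is_comp (V - B) C \<longrightarrow> finite (C \<inter> B') \<and>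
        (\<forall>x\<in>C \<inter> B'. p' x \<notin> C \<longrightarrow> (\<forall>z\<in>nbhd C. l (p' x) \<le> l z)) \<and>
        (C \<inter> (\<Union>k. U k) \<noteq> {} \<longrightarrow> conn (C \<inter> B') \<and> (\<forall>k. C \<inter> U k \<noteq> {} \<longrightarrow> C \<inter> B' \<inter> U k \<noteq> {}) \<and>
          ((\<exists>z\<in>nbhd C. l z = n) \<longrightarrow> (\<exists>z\<in>nbhd C. l z = n \<and> (\<exists>y\<in>C \<inter> B'. adj y z)))))"

text \<open>Components that meet no \<open>U k\<close> are left alone; in the others the sets from
  \<open>component_step\<close> are disjoint, so their forests combine by \<open>rforest_UN\<close>.
  A new component lies in an old one \<open>C\<close>, and its neighbours lie in
  \<open>nbhd C\<close> or among the finitely many vertices just added to \<open>C\<close>; this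
  keeps neighbourhoods finite outside \<open>A\<close>.\<close>

lemma stage_exists:
  assumes V: "conn V" and A: "A \<noteq> {}" and U: "mono U" and inv: "stage_inv A n B l p"
  shows "\<exists>B' l' p'. stage_inv A (Suc n) B' l' p' \<and> stage_step U A n B l p B' l' p'"
proof -
  define I where "I = {C. is_comp (V - B) C \<and> C \<inter> (\<Union>k. U k) \<noteq> {}}"
  define Q where "Q C F q \<longleftrightarrow> finite F \<and> F \<subseteq> C \<and> conn F \<and> (\<forall>k. C \<inter> U k \<noteq> {} \<longrightarrow> F \<inter> U k \<noteq> {}) \<and>
    ((\<exists>z\<in>nbhd C. l z = n) \<longrightarrow> (\<exists>z\<in>nbhd C. l z = n \<and> (\<exists>y\<in>F. adj y z))) \<and>
    (\<forall>x\<in>F. q x \<notin> F \<longrightarrow> (\<forall>z\<in>nbhd C. l (q x) \<le> l z))" for C F and q :: "'a \<Rightarrow> 'a"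
  have AB: "A \<subseteq> B" "B \<subseteq> V" and lB: "\<And>x. x \<in> B \<Longrightarrow> l x \<le> n \<and> (l x = 0 \<longleftrightarrow> x \<in> A)"
    and rf: "rforest A (B - A) p" and fin: "\<And>C. is_comp (V - B) C \<Longrightarrow> finite (nbhd C - A)"
    using inv unfolding stage_inv_def by auto
  have "\<exists>F q. rforest B F q \<and> Q C F q" if "C \<in> I" for C
  proof -
    have C: "is_comp (V - B) C" "C \<inter> (\<Union>k. U k) \<noteq> {}" using that by (auto simp: I_def)
    obtain a where "a \<in> A" using A by blast
    moreover obtain x where "x \<in> C" using C by blast
    ultimately have "nbhd C \<noteq> {}"
      using C AB by (intro conn_nbhd_nonempty[OF V, of x C a]) (auto simp: is_comp_def)
    from component_step[OF C(1) this U C(2), of l n] show ?thesis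
      unfolding Q_def by (smt (verit))
  qed
  then obtain F where F: "\<And>C. C \<in> I \<Longrightarrow> \<exists>q. rforest B (F C) q \<and> Q C (F C) q"
    by metis
  have FC: "F C \<subseteq> C" if "C \<in> I" for C using F[OF that] by (auto simp: Q_def)
  have disj: "C = D" if "C \<in> I" "D \<in> I" "x \<in> C" "x \<in> D" for C D x
    using that comp_eq by (auto simp: I_def)
  obtain q where q: "rforest B (\<Union>C\<in>I. F C) q" "\<And>C. C \<in> I \<Longrightarrow> Q C (F C) q"
  proof (rule rforest_UN[of I B F "\<lambda>C. Q C (F C)"])
    show "C = D" if "C \<in> I" "D \<in> I" "x \<in> F C" "x \<in> F D" for C D x
      using that FC disj by blast
    show "Q C (F C) q" if "C \<in> I" "Q C (F C) p" "\<And>x. x \<in> F C \<Longrightarrow> q x = p x" for C p q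
      using that(2,3) unfolding Q_def by simp
  qed (use F in auto)
  define B' where "B' = B \<union> (\<Union>C\<in>I. F C)"
  define l' where "l' x = (if x \<in> B then l x else Suc n)" for x
  define p' where "p' x = (if x \<in> B - A then p x else q x)" for x
  have CB': "C \<inter> B' = F C" if C: "C \<in> I" for C
  proof
    have "C \<inter> B = {}" using C unfolding I_def is_comp_def by blast
    moreover have "x \<in> F C" if "x \<in> C" "x \<in> F D" "D \<in> I" for x D
      using disj[OF C that(3,1)] FC[OF that(3)] that by blast
    ultimately show "C \<inter> B' \<subseteq> F C" unfolding B'_def by blast
    show "F C \<subseteq> C \<inter> B'" using C FC unfolding B'_def by blast
  qed
  have CB'0: "C \<inter> B' = {}" if C: "is_comp (V - B) C" "C \<notin> I" for C
  proof -
    have "C \<inter> D = {}" if "D \<in> I" for D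
      using comp_eq[OF C(1), of D] C(2) that unfolding I_def by blast
    then have "C \<inter> F D = {}" if "D \<in> I" for D using FC that by blast
    then show ?thesis using C(1) unfolding B'_def is_comp_def by blast
  qed
  have BV: "B' \<subseteq> V" using AB FC unfolding B'_def I_def is_comp_def by blast
  have rf': "rforest A (B' - A) p'"
  proof -
    have "A \<union> (B - A) = B" using AB by blast
    moreover have "(B - A) \<union> (\<Union>C\<in>I. F C) = B' - A"
      using rforestD(1)[OF q(1)] AB unfolding B'_def by blast
    ultimately show ?thesis using rforest_Un[OF rf, of "\<Union>C\<in>I. F C" q] q(1) unfolding p'_def by simp
  qed
  have step: "stage_step U A n B l p B' l' p'"
    unfolding stage_step_def
  proof (intro conjI allI impI)
    fix C assume C: "is_comp (V - B) C"
    show "finite (C \<inter> B')"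
      using CB' CB'0 C q(2) unfolding Q_def by (metis finite.emptyI)
    show "\<forall>x\<in>C \<inter> B'. p' x \<notin> C \<longrightarrow> (\<forall>z\<in>nbhd C. l (p' x) \<le> l z)"
    proof (intro ballI impI)
      fix x z assume x: "x \<in> C \<inter> B'" and p': "p' x \<notin> C" and z: "z \<in> nbhd C"
      have CI: "C \<in> I" using CB'0[OF C] x by blast
      have "p' x = q x" using x C unfolding p'_def is_comp_def by auto
      then show "l (p' x) \<le> l z" using q(2)[OF CI] x p' z CB'[OF CI] FC[OF CI] unfolding Q_def by auto
    qed
    assume "C \<inter> (\<Union>k. U k) \<noteq> {}"
    then have CI: "C \<in> I" using C by (simp add: I_def)
    then show "conn (C \<inter> B')" using q(2)[OF CI] CB'[OF CI] unfolding Q_def by simp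
    show "\<exists>z\<in>nbhd C. l z = n \<and> (\<exists>y\<in>C \<inter> B'. adj y z)" if "\<exists>z\<in>nbhd C. l z = n"
      using q(2)[OF CI] CB'[OF CI] that unfolding Q_def by auto
    fix k assume "C \<inter> U k \<noteq> {}"
    then show "C \<inter> B' \<inter> U k \<noteq> {}"
      using q(2)[OF CI] CB'[OF CI] unfolding Q_def by simp
  qed (auto simp: B'_def l'_def p'_def)
  have fin': "finite (nbhd C' - A)" if C': "is_comp (V - B') C'" for C'
  proof -
    obtain x where x: "x \<in> C'" using C' by (auto simp: is_comp_def)
    then have "x \<in> V - B" using C' unfolding is_comp_def B'_def by blast
    then obtain C where C: "is_comp (V - B) C" "x \<in> C" by (rule exists_comp)
    have CC: "C' \<subseteq> C"
      using C' C x by (intro conn_subset_comp[OF C(1), of C' x]) (auto simp: is_comp_def B'_def)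
    have "nbhd C' \<subseteq> nbhd C \<union> (C \<inter> B')"
    proof
      fix y assume y: "y \<in> nbhd C'"
      then have "y \<in> B'" using comp_nbhd_subset[OF C'] by blast
      then show "y \<in> nbhd C \<union> (C \<inter> B')" using y CC unfolding nbhd_def by blast
    qed
    then have "nbhd C' - A \<subseteq> (nbhd C - A) \<union> (C \<inter> B')" by blast
    moreover have "finite (C \<inter> B')" using step C(1) unfolding stage_step_def by simp
    ultimately show ?thesis using fin[OF C(1)] by (meson finite_Un finite_subset)
  qed
  have "stage_inv A (Suc n) B' l' p'"
    unfolding stage_inv_def using AB BV rf' fin' lB by (auto simp: B'_def l'_def le_Suc_eq)
  then show ?thesis using step by blast
qed

text \<open>A vertex that dominates \<open>R\<close> cannot be separated from its tails by a finite set. This form of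
  domination mentions no paths.\<close>

definition dominated_rays :: bool where
  "dominated_rays \<longleftrightarrow> (\<forall>R. inj R \<and> (\<forall>i::nat. R i \<in> V \<and> adj (R i) (R (Suc i))) \<longrightarrow>
     (\<exists>w\<in>V. \<forall>C n. C \<subseteq> V \<and> finite (nbhd C) \<and> (\<forall>i\<ge>n. R i \<in> C) \<longrightarrow> w \<in> C \<union> nbhd C))"

text \<open>Dependent choice, starting from the empty forest over \<open>A\<close> with all labels
  0. At that stage every component of the rest has its neighbours in \<open>A\<close>, so the
  finiteness condition is trivial.\<close>

lemma stages:
  fixes U :: "nat \<Rightarrow> 'a set"
  assumes "conn V" "A \<noteq> {}" "A \<subseteq> V" "mono U"
  obtains B l p where "B 0 = A" "\<And>n. stage_inv A n (B n) (l n) (p n)"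
    "\<And>n. stage_step U A n (B n) (l n) (p n) (B (Suc n)) (l (Suc n)) (p (Suc n))"
proof -
  define P where "P n s = (case s of (B, l, p) \<Rightarrow> stage_inv A n B l p \<and> (n = 0 \<longrightarrow> B = A))" for n s
  define Q where "Q n s s' = (case s of (B, l, p) \<Rightarrow> case s' of (B', l', p') \<Rightarrow>
    stage_step U A n B l p B' l' p')" for n s s'
  have "rforest A {} (\<lambda>x. x)" by (simp add: rforest_def)
  moreover have "finite (nbhd C - A)" if "is_comp (V - A) C" for C
    using comp_nbhd_subset[OF that] by (simp add: Diff_eq_empty_iff[THEN iffD2])
  ultimately have "P 0 (A, \<lambda>_. 0, \<lambda>x. x)"
    using assms(3) by (simp add: P_def stage_inv_def)
  moreover have "\<exists>s'. P (Suc n) s' \<and> Q n s s'" if "P n s" for n s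
    using stage_exists[OF assms(1,2,4), of n "fst s" "fst (snd s)" "snd (snd s)"] that
    by (auto simp: P_def Q_def split: prod.splits)
  ultimately have "\<exists>f. \<forall>n. P n (f n) \<and> Q n (f n) (f (Suc n))"
    by (intro dependent_nat_choice) blast+
  then obtain f where f: "\<And>n. P n (f n)" "\<And>n. Q n (f n) (f (Suc n))" by blast
  show ?thesis
  proof
    show "fst (f 0) = A" using f(1)[of 0] by (auto simp: P_def split: prod.splits)
    show "stage_inv A n (fst (f n)) (fst (snd (f n))) (snd (snd (f n)))" for n
      using f(1)[of n] by (auto simp: P_def split: prod.splits)
    show "stage_step U A n (fst (f n)) (fst (snd (f n))) (snd (snd (f n)))
      (fst (f (Suc n))) (fst (snd (f (Suc n)))) (snd (snd (f (Suc n))))" for n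
      using f(2)[of n] by (auto simp: Q_def split: prod.splits)
  qed
qed

text \<open>A repetition in an ascending chain is a closed walk; running around it towards the
  parents forever gives a forbidden descending chain.\<close>

lemma parent_chain_inj:
  assumes down: "\<And>g::nat \<Rightarrow> 'a. (\<And>i. g i \<in> B \<and> g (Suc i) = p (g i)) \<Longrightarrow> False" and f: "\<And>i::nat. f (Suc i) \<in> B \<and> p (f (Suc i)) = f i"
  shows "inj f"
proof (rule linorder_injI)
  fix i j :: nat assume "i < j"
  show "f i \<noteq> f j"
  proof
    assume eq: "f i = f j"
    define d where "d = j - i"
    have d: "d > 0" "j = i + d" using \<open>i < j\<close> by (auto simp: d_def)
    \<comment> \<open>The index runs through \<open>j\<close>, \<open>j - 1\<close>, ...,
      \<open>i + 1\<close> and then starts again at \<open>j\<close>. It is always positive, so all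
      values lie in \<open>B\<close>.\<close>
    define g where "g m = f (j - m mod d)" for m
    have "g m \<in> B \<and> g (Suc m) = p (g m)" for m
    proof -
      define k where "k = j - m mod d"
      have md: "m mod d < d" using d by simp
      then have "k > 0" using d unfolding k_def by linarith
      then obtain k' where k': "k = Suc k'" by (cases k) auto
      have B: "f k \<in> B" "p (f k) = f k'" using f[of k'] k' by auto
      have "g (Suc m) = f k'"
      proof (cases "Suc (m mod d) = d")
        case True
        then have "k = Suc i" using d k_def by simp
        then have "k' = i" using k' by simp
        moreover have "Suc m mod d = 0" using True by (simp add: mod_Suc)
        ultimately show ?thesis using eq by (simp add: g_def)
      next
        case False
        then have "Suc m mod d = Suc (m mod d)" by (simp add: mod_Suc)
        moreover have "j - Suc (m mod d) = k'" using k' k_def by linarith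
        ultimately show ?thesis by (simp add: g_def)
      qed
      then show ?thesis using B by (simp add: g_def k_def)
    qed
    then show False using down by blast
  qed
qed

text \<open>Tameness of the \<open>U k\<close> ensures that the union of the stages misses none of
  their vertices; domination excludes ascending chains in the limit forest. Descending chains stay
  within one stage.\<close>

lemma rforest_covering:
  fixes U :: "nat \<Rightarrow> 'a set"
  assumes V: "conn V" and A: "A \<noteq> {}" "A \<subseteq> V"
    and U: "mono U" "\<And>k. U k \<subseteq> V" "\<And>k. tame (U k)" and dom: dominated_rays
  shows "\<exists>B p. B \<subseteq> V \<and> (\<Union>k. U k) \<subseteq> A \<union> B \<and> rforest A B p"
proof -
  obtain Bs ls ps where B0: "Bs 0 = A" and inv: "\<And>n. stage_inv A n (Bs n) (ls n) (ps n)"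
    and next_stage: "\<And>n. stage_step U A n (Bs n) (ls n) (ps n) (Bs (Suc n)) (ls (Suc n)) (ps (Suc n))"
    using stages[OF V A U(1)] by metis
  define B where "B = (\<Union>n. Bs n)"
  \<comment> \<open>Labels and parents never change once assigned, so the maps \<open>ls n\<close>
    and \<open>ps n\<close> merge into global ones: \<open>l x\<close> is the first stage containing
    \<open>x\<close>.\<close>
  define l where "l x = (LEAST n. x \<in> Bs n)" for x
  define p where "p x = ps (l x) x" for x
  have Bsuc: "Bs n \<subseteq> Bs (Suc n)" for n
    using next_stage[of n] by (simp add: stage_step_def)
  have Bmono: "Bs m \<subseteq> Bs n" if "m \<le> n" for m n
    using lift_Suc_mono_le[of Bs, OF Bsuc that] .
  have lB: "x \<in> Bs n \<longleftrightarrow> x \<in> B \<and> l x \<le> n" for x n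
  proof -
    have "x \<in> Bs (l x)" if "x \<in> B"
      using that LeastI_ex[of "\<lambda>n. x \<in> Bs n"] unfolding B_def l_def by blast
    moreover have "l x \<le> n" if "x \<in> Bs n" unfolding l_def using that by (rule Least_le)
    ultimately show ?thesis using Bmono[of "l x" n] unfolding B_def by blast
  qed
  have AB: "A \<subseteq> Bs n" for n using Bmono[of 0 n] B0 by simp
  have BV: "Bs n \<subseteq> V" for n using inv[of n] by (simp add: stage_inv_def)
  have l0: "x \<in> A \<longleftrightarrow> x \<in> B \<and> l x = 0" for x using lB[of x 0] B0 by simp
  have ls: "ls n x = l x" if "x \<in> Bs n" for x n
    using that
  proof (induction n)
    case 0
    then show ?case using lB[of x 0] inv[of 0] B0 by (simp add: stage_inv_def)
  next
    case (Suc n)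
    show ?case
    proof (cases "x \<in> Bs n")
      case True
      then show ?thesis using Suc.IH next_stage[of n] by (simp add: stage_step_def)
    next
      case False
      then have "l x = Suc n" using lB Suc.prems by (meson le_SucE)
      then show ?thesis using False next_stage[of n] Suc.prems by (simp add: stage_step_def)
    qed
  qed
  have ps: "ps n x = p x" if "x \<in> Bs n - A" for x n
  proof -
    have "l x \<le> n" "x \<in> Bs (l x)" using that lB by auto
    then show ?thesis
    proof (induction n rule: dec_induct)
      case (step m)
      have "x \<in> Bs m - A" using step that lB by blast
      then have "ps (Suc m) x = ps m x" using next_stage[of m] by (simp add: stage_step_def)
      then show ?case using step by simp
    qed (simp add: p_def)
  qed
  have rf: "rforest A (Bs n - A) p" for n
    using inv[of n] ps[of _ n] rforest_cong[of A "Bs n - A" "ps n" p] by (simp add: stage_inv_def)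
  have p: "p x \<in> Bs n" "adj x (p x)" if "x \<in> Bs n - A" for x n
    using rforestD(2,3)[OF rf that] AB[of n] by auto
  have pl: "p x \<in> B" "l (p x) \<le> l x" "adj x (p x)" if "x \<in> B - A" for x
    using p[of x "l x"] that lB by auto
  have fin: "finite (nbhd C - A)" if "is_comp (V - Bs n) C" for C n
    using inv[of n] that by (simp add: stage_inv_def)
  \<comment> \<open>The clauses of \<open>stage_step\<close>, restated with the global
    \<open>l\<close> and \<open>p\<close>.\<close>
  have st: "finite (C \<inter> Bs (Suc n))"
    "\<And>x z. x \<in> C \<inter> Bs (Suc n) \<Longrightarrow> p x \<notin> C \<Longrightarrow> z \<in> nbhd C \<Longrightarrow> l (p x) \<le> l z"
    "C \<inter> (\<Union>k. U k) \<noteq> {} \<Longrightarrow> conn (C \<inter> Bs (Suc n))"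
    "\<And>k. C \<inter> U k \<noteq> {} \<Longrightarrow> C \<inter> Bs (Suc n) \<inter> U k \<noteq> {}"
    "\<And>z. C \<inter> (\<Union>k. U k) \<noteq> {} \<Longrightarrow> z \<in> nbhd C \<Longrightarrow> l z = n \<Longrightarrow>
       \<exists>z\<in>nbhd C. l z = n \<and> (\<exists>y\<in>C \<inter> Bs (Suc n). adj y z)"
    if C: "is_comp (V - Bs n) C" for C n
  proof -
    have CA: "C \<inter> Bs n = {}" using C by (auto simp: is_comp_def)
    have nl: "ls n z = l z" if "z \<in> nbhd C" for z
      using ls comp_nbhd_subset[OF C] that by blast
    have pe: "ps (Suc n) x = p x" if "x \<in> C \<inter> Bs (Suc n)" for x
      using ps that CA AB by blast
    have *: "finite (C \<inter> Bs (Suc n)) \<and>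
        (\<forall>x\<in>C \<inter> Bs (Suc n). ps (Suc n) x \<notin> C \<longrightarrow> (\<forall>z\<in>nbhd C. ls n (ps (Suc n) x) \<le> ls n z)) \<and>
        (C \<inter> (\<Union>k. U k) \<noteq> {} \<longrightarrow> conn (C \<inter> Bs (Suc n)) \<and> (\<forall>k. C \<inter> U k \<noteq> {} \<longrightarrow> C \<inter> Bs (Suc n) \<inter> U k \<noteq> {}) \<and>
          ((\<exists>z\<in>nbhd C. ls n z = n) \<longrightarrow> (\<exists>z\<in>nbhd C. ls n z = n \<and> (\<exists>y\<in>C \<inter> Bs (Suc n). adj y z))))"
      using next_stage[of n] C unfolding stage_step_def by blast
    show "finite (C \<inter> Bs (Suc n))" using * by blast
    show "l (p x) \<le> l z" if "x \<in> C \<inter> Bs (Suc n)" "p x \<notin> C" "z \<in> nbhd C" for x z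
    proof -
      have "x \<in> Bs (Suc n) - A" using that CA AB by blast
      then have "adj x (p x)" using p by blast
      then have "p x \<in> nbhd C" using that by (auto simp: nbhd_def)
      then show ?thesis using * that pe[OF that(1)] nl by metis
    qed
    show "conn (C \<inter> Bs (Suc n))" if "C \<inter> (\<Union>k. U k) \<noteq> {}" using * that by blast
    show "C \<inter> Bs (Suc n) \<inter> U k \<noteq> {}" if "C \<inter> U k \<noteq> {}" for k
    proof -
      have "C \<inter> (\<Union>k. U k) \<noteq> {}" using that by blast
      then show ?thesis using * that by blast
    qed
    show "\<exists>z\<in>nbhd C. l z = n \<and> (\<exists>y\<in>C \<inter> Bs (Suc n). adj y z)"
      if "C \<inter> (\<Union>k. U k) \<noteq> {}" "z \<in> nbhd C" "l z = n" for z
      using * that nl by metis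
  qed

  \<comment> \<open>If \<open>u\<close> were never reached, the sets \<open>F m\<close> added in the
    components \<open>C m\<close> around \<open>u\<close> would be disjoint, connected,
    consecutively adjacent and all meet \<open>U K\<close>, contradicting tameness.\<close>
  have cover: "u \<in> B" if u: "u \<in> U K" for u K
  proof (rule ccontr)
    assume "u \<notin> B"
    then have uV: "u \<in> V - Bs m" for m using U(2)[of K] u lB by blast
    define C where "C m = {z. reach (V - Bs m) u z}" for m
    have C: "is_comp (V - Bs m) (C m)" "u \<in> C m" for m
      using comp_of[OF uV[of m]] by (auto simp: C_def)
    define F where "F m = C m \<inter> Bs (Suc m)" for m
    have ne: "C m \<inter> U K \<noteq> {}" "C m \<inter> (\<Union>k. U k) \<noteq> {}" for m using C(2)[of m] u by blast+
    have Fm: "conn (F m)" "F m \<inter> U K \<noteq> {}" for m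
      using st(3)[OF C(1) ne(2)] st(4)[OF C(1) ne(1)] by (auto simp: F_def)
    have FB: "F m \<subseteq> Bs (Suc m)" "F m \<inter> Bs m = {}" for m
      using C(1)[of m] by (auto simp: F_def is_comp_def)
    have FV: "F m \<subseteq> V" for m using FB BV by blast
    have disj: "F m \<inter> F n = {}" if "m \<noteq> n" for m n
    proof -
      have "F i \<inter> F j = {}" if "i < j" for i j
        using FB(1)[of i] FB(2)[of j] Bmono[of "Suc i" j] that by fastforce
      then show ?thesis using that by (metis inf_commute linorder_neqE_nat)
    qed
    have "\<exists>x\<in>F m. \<exists>y\<in>F (Suc m). adj x y" for m
    proof -
      have CC: "C (Suc m) \<subseteq> C m"
        using C(1)[of "Suc m"] C(2) Bsuc[of m]
        by (intro conn_subset_comp[OF C(1)[of m], of "C (Suc m)" u]) (auto simp: is_comp_def)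
      \<comment> \<open>As \<open>F m\<close> is nonempty, \<open>C (Suc m)\<close> is a proper part
        of the connected set \<open>C m\<close>. An edge of \<open>C m\<close> leaving it ends in a
        vertex \<open>y\<close> of label \<open>Suc m\<close>, which is the newest neighbour that
        \<open>st(5)\<close> asks for.\<close>
      obtain w where w: "w \<in> F m" using Fm(2) by blast
      then have w': "w \<in> C m" "w \<notin> C (Suc m)"
        using C(1)[of "Suc m"] by (auto simp: F_def is_comp_def)
      have "conn (C m)" using C(1) by (simp add: is_comp_def)
      then obtain x y where xy: "x \<in> C m" "y \<in> C m" "x \<in> C (Suc m)" "y \<notin> C (Suc m)" "adj x y"
        using conn_edge[of "C m" u "C (Suc m)" w] C(2) w' by metis
      have ynb: "y \<in> nbhd (C (Suc m))" using xy by (auto simp: nbhd_def)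
      have in_F: "z \<in> F m" if z: "z \<in> nbhd (C (Suc m))" "l z = Suc m" for z
      proof -
        have zB: "z \<in> Bs (Suc m)" using comp_nbhd_subset[OF C(1)] z by blast
        have znB: "z \<notin> Bs m" using z lB by simp
        obtain c where "c \<in> C (Suc m)" "adj c z" using z by (auto simp: nbhd_def)
        then have "z \<in> C m" using C(1)[of m] CC znB zB BV unfolding is_comp_def by blast
        then show ?thesis using zB by (simp add: F_def)
      qed
      have "y \<in> Bs (Suc m)" using comp_nbhd_subset[OF C(1)] ynb by blast
      moreover have "y \<notin> Bs m" using xy C(1)[of m] by (auto simp: is_comp_def)
      ultimately have "l y = Suc m" using lB by (meson le_SucE)
      from st(5)[OF C(1) ne(2) ynb this] obtain z y' where
        "z \<in> nbhd (C (Suc m))" "l z = Suc m" "y' \<in> F (Suc m)" "adj y' z"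
        by (auto simp: F_def)
      then show ?thesis using in_F adj_sym by blast
    qed
    then have "\<not> tame (U K)" unfolding tame_def using Fm FV disj by blast
    then show False using U(3) by blast
  qed

  \<comment> \<open>Labels do not increase towards the parents, so the chain stays in the forest of
    stage \<open>l (f 0)\<close>.\<close>
  have down: False if f: "\<And>i::nat. f i \<in> B - A \<and> f (Suc i) = p (f i)" for f
  proof -
    define n where "n = l (f 0)"
    have "f i \<in> Bs n - A" for i
    proof (induction i)
      case 0
      then show ?case using f[of 0] lB unfolding n_def by blast
    next
      case (Suc i)
      then show ?case using p(1)[OF Suc] f[of i] f[of "Suc i"] by auto
    qed
    then show False using rforestD(4)[OF rf[of n], of f] f by blast
  qed
  have up: False if f: "\<And>i::nat. f (Suc i) \<in> B - A \<and> p (f (Suc i)) = f i" for f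
  proof -
    have fB: "f i \<in> B" for i using f[of i] pl(1)[of "f (Suc i)"] by metis
    have lsuc: "l (f i) \<le> l (f (Suc i))" for i using f[of i] pl(2)[of "f (Suc i)"] by metis
    have lmono: "l (f i) \<le> l (f j)" if "i \<le> j" for i j
      using lift_Suc_mono_le[of "\<lambda>i. l (f i)", OF lsuc that] .
    \<comment> \<open>Bounded labels would place the whole chain in the forest of a single
      stage.\<close>
    have unb: "\<exists>j. l (f j) > n" for n
    proof (rule ccontr)
      assume "\<not> ?thesis"
      then have "f i \<in> Bs n" for i using fB lB by (meson not_less)
      then show False using rforestD(5)[OF rf[of n], of f] f by auto
    qed
    have fadj: "adj (f i) (f (Suc i))" for i
      using pl(3)[of "f (Suc i)"] f[of i] adj_sym by metis
    \<comment> \<open>Choose \<open>j\<close> with \<open>k < l (f j) < l (f (Suc j))\<close>. The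
      component \<open>C\<close> in which \<open>f (Suc j)\<close> was added contains the rest of
      the chain, while the parent \<open>f j\<close> lies outside \<open>C\<close>. Parents outside
      are oldest neighbours, so all labels in \<open>nbhd C\<close> are at least
      \<open>l (f j)\<close>.\<close>
    have deep: "\<exists>C m n. is_comp (V - Bs m) C \<and> k \<le> m \<and> (\<forall>i\<ge>n. f i \<in> C) \<and> (\<forall>z\<in>nbhd C. l z > k)" for k
    proof -
      obtain j0 where j0: "l (f j0) > k" using unb by blast
      obtain j1 where j1: "l (f j1) > l (f j0)" using unb by blast
      have "\<exists>j\<ge>j0. l (f (Suc j)) > l (f j)"
      proof (rule ccontr)
        assume "\<not> ?thesis"
        then have le: "l (f (Suc j)) \<le> l (f j)" if "j \<ge> j0" for j using that by (meson not_less)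
        have "l (f j) \<le> l (f j0)" if "j \<ge> j0" for j
          using that by (induction rule: dec_induct) (use le in \<open>auto intro: order_trans\<close>)
        moreover have "j1 \<ge> j0" using j1 lmono[of j1 j0] by (meson leD nle_le)
        ultimately show False using j1 by (meson leD)
      qed
      then obtain j where j: "j \<ge> j0" "l (f (Suc j)) > l (f j)" by blast
      obtain m where m: "l (f (Suc j)) = Suc m" using j(2) by (cases "l (f (Suc j))") auto
      have lj: "k < l (f j)" "l (f j) \<le> m" using j0 lmono[OF j(1)] j(2) m by auto
      have notin: "f i \<in> V - Bs m" if "i \<ge> Suc j" for i
      proof -
        have "l (f i) > m" using lmono[OF that] m by simp
        then show ?thesis using lB fB[of i] BV by fastforce
      qed
      obtain C where C: "is_comp (V - Bs m) C" "f (Suc j) \<in> C"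
        using exists_comp[OF notin[of "Suc j"]] by auto
      have "f i \<in> C" if "i \<ge> Suc j" for i
        using that
      proof (induction rule: dec_induct)
        case (step i)
        then show ?case using C(1) notin[of "Suc i"] fadj[of i] unfolding is_comp_def by auto
      qed (use C in simp)
      moreover have "k < l z" if "z \<in> nbhd C" for z
      proof -
        have "f j \<in> Bs m" using lj lB fB by blast
        then have "p (f (Suc j)) \<notin> C" using C(1) f[of j] by (auto simp: is_comp_def)
        moreover have "f (Suc j) \<in> Bs (Suc m)" using m lB fB by simp
        ultimately have "l (f j) \<le> l z" using st(2)[OF C(1), of "f (Suc j)" z] C(2) that f[of j] by auto
        then show ?thesis using lj by simp
      qed
      ultimately show ?thesis using C(1) lj by (meson less_imp_le order_trans)
    qed
    have inj: "inj f" using parent_chain_inj[of "B - A" p f] down f by blast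
    have fV: "f i \<in> V" for i using fB BV lB by blast
    obtain w where w: "w \<in> V"
      "\<And>C n. C \<subseteq> V \<Longrightarrow> finite (nbhd C) \<Longrightarrow> \<forall>i\<ge>n. f i \<in> C \<Longrightarrow> w \<in> C \<union> nbhd C"
      using dom inj fV fadj unfolding dominated_rays_def by metis
    have deepw: "\<exists>C m. is_comp (V - Bs m) C \<and> k \<le> m \<and> w \<in> C \<union> nbhd C \<and> (\<forall>z\<in>nbhd C. l z > k)" for k
    proof -
      obtain C m n where C: "is_comp (V - Bs m) C" "k \<le> m" "\<forall>i\<ge>n. f i \<in> C" "\<forall>z\<in>nbhd C. l z > k"
        using deep by blast
      \<comment> \<open>Labels above \<open>k\<close> are positive, so \<open>nbhd C\<close> avoids
        \<open>A\<close> and the stage invariant makes it finite. Only then does domination force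
        \<open>w\<close> into \<open>C\<close> or \<open>nbhd C\<close>.\<close>
      have "nbhd C \<inter> A = {}" using C(4) l0 by fastforce
      then have "finite (nbhd C)" using fin[OF C(1)] by (simp add: Diff_triv)
      moreover have "C \<subseteq> V" using C(1) by (auto simp: is_comp_def)
      ultimately show ?thesis using C w(2)[of C n] by blast
    qed
    show False
    proof (cases "w \<in> B")
      case True
      \<comment> \<open>With \<open>k = l w\<close>, the vertex \<open>w\<close> is already in
        \<open>Bs m\<close>, hence outside \<open>C\<close>, and its own label is too small for a
        vertex of \<open>nbhd C\<close>.\<close>
      obtain C m where C: "is_comp (V - Bs m) C" "l w \<le> m" "w \<in> C \<union> nbhd C" "\<forall>z\<in>nbhd C. l z > l w"
        using deepw by blast
      have "w \<in> Bs m" using True C(2) lB by blast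
      then have "w \<notin> C" using C(1) by (auto simp: is_comp_def)
      then show False using C(3,4) by auto
    next
      case False
      \<comment> \<open>Here \<open>w\<close> is never reached. Its component \<open>D\<close> of
        the unreached part has a neighbour \<open>y\<close> in \<open>B\<close>, as \<open>G\<close>
        is connected. A component \<open>C\<close> as in \<open>deepw\<close> for
        \<open>k = l y\<close> contains \<open>D\<close> but not \<open>y\<close>, so
        \<open>y\<close> is a neighbour of \<open>C\<close> whose label is too small.\<close>
      obtain D where D: "is_comp (V - B) D" "w \<in> D" using exists_comp[of w "V - B"] w(1) False by blast
      obtain a where a: "a \<in> A" using A by blast
      have aB: "a \<in> B" using a l0 by blast
      have "nbhd D \<noteq> {}"
        using conn_nbhd_nonempty[OF V D(2), of a] D(1) a A(2) aB by (auto simp: is_comp_def)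
      then obtain y w' where y: "y \<in> nbhd D" "w' \<in> D" "adj w' y" by (auto simp: nbhd_def)
      have yB: "y \<in> B" using comp_nbhd_subset[OF D(1)] y by blast
      obtain C m where C: "is_comp (V - Bs m) C" "l y \<le> m" "w \<in> C \<union> nbhd C" "\<forall>z\<in>nbhd C. l z > l y"
        using deepw by blast
      have "w \<notin> nbhd C" using comp_nbhd_subset[OF C(1)] False lB by blast
      then have "w \<in> C" using C(3) by blast
      moreover have "D \<subseteq> V - Bs m" using D(1) lB by (auto simp: is_comp_def)
      ultimately have "D \<subseteq> C" using D by (intro conn_subset_comp[OF C(1), of D w]) (auto simp: is_comp_def)
      moreover have "y \<in> Bs m" using yB C(2) lB by blast
      then have "y \<notin> C" using C(1) by (auto simp: is_comp_def)
      ultimately have "y \<in> nbhd C" using y by (auto simp: nbhd_def)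
      then show False using C(4) by auto
    qed
  qed
  have "rforest A (B - A) p"
    unfolding rforest_def using down up pl by blast
  moreover have "B - A \<subseteq> V" using BV lB by blast
  moreover have "(\<Union>k. U k) \<subseteq> A \<union> (B - A)" using cover by blast
  ultimately show ?thesis by blast
qed

end

section \<open>Rooted trees and normal trees\<close>

text \<open>If two paths from \<open>a\<close> differ in their second vertices, a cycle arises:
  follow the first to its first vertex \<open>x\<close> on the second, then return along the
  second.\<close>

lemma tree_path_unique:
  assumes "tree T"
  shows "path T p \<Longrightarrow> path T q \<Longrightarrow> hd p = hd q \<Longrightarrow> last p = last q \<Longrightarrow> p = q"
proof (induction p arbitrary: q)
  case (Cons a p')
  obtain q' where q: "q = a # q'"
    using Cons.prems(2,3) by (cases q) (auto simp: path_def)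
  have dist: "distinct (a # p')" "distinct (a # q')" using Cons.prems q by (auto simp: path_def)
  show ?case
  proof (cases "p' = [] \<or> q' = []")
    case True
    then show ?thesis using Cons.prems(4) dist q last_in_set by (metis distinct.simps(2) last.simps)
  next
    case False
    then have ne: "p' \<noteq> []" "q' \<noteq> []" by auto
    have sub: "path T p'" "path T q'" "last p' = last q'"
      using Cons.prems q ne by (auto simp: path_def successively_Cons)
    show ?thesis
    proof (cases "hd p' = hd q'")
      case True
      then show ?thesis using Cons.IH[OF sub(1,2) True sub(3)] q by simp
    next
      case False
      have "last p' \<in> set q'" using sub(3) ne by simp
      then obtain p1 x p2 where p: "p' = p1 @ x # p2" "x \<in> set q'" "\<forall>y\<in>set p1. y \<notin> set q'"
        using split_list_first_prop[of p' "\<lambda>y. y \<in> set q'"] ne last_in_set by metis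
      then obtain q1 q2 where q': "q' = q1 @ x # q2" by (meson split_list)
      let ?c = "a # p1 @ x # rev q1"
      have sym: "(\<lambda>u v. {u, v} \<in> edges T) = (\<lambda>v u. {u, v} \<in> edges T)" by (simp add: insert_commute)
      have sp: "successively (\<lambda>u v. {u, v} \<in> edges T) (a # p1 @ x # p2)"
        "successively (\<lambda>u v. {u, v} \<in> edges T) (a # q1 @ x # q2)"
        using Cons.prems q p q' by (auto simp: path_def)
      have "successively (\<lambda>u v. {u, v} \<in> edges T) (x # rev q1)"
      proof -
        have "successively (\<lambda>u v. {u, v} \<in> edges T) (q1 @ [x])"
          using sp(2) by (auto simp: successively_Cons successively_append_iff)
        then have "successively (\<lambda>u v. {u, v} \<in> edges T) (rev (q1 @ [x]))"
          by (subst successively_rev) (simp add: insert_commute)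
        then show ?thesis by simp
      qed
      then have "successively (\<lambda>u v. {u, v} \<in> edges T) ?c"
        using sp(1) by (auto simp: successively_Cons successively_append_iff hd_append split: if_splits)
      moreover have "distinct ?c" using dist p q' by auto
      moreover have "set ?c \<subseteq> verts T" using Cons.prems q p q' by (auto simp: path_def)
      ultimately have "path T ?c" by (simp add: path_def)
      moreover have "3 \<le> length ?c"
      proof -
        have "p1 \<noteq> [] \<or> q1 \<noteq> []" using False p q' by auto
        then show ?thesis by (cases p1; cases q1) auto
      qed
      moreover have "{last ?c, hd ?c} \<in> edges T"
      proof (cases q1)
        case Nil
        then show ?thesis using sp(2) by (simp add: successively_Cons insert_commute)
      next
        case (Cons b q3)
        then show ?thesis using sp(2) by (simp add: successively_Cons insert_commute)
      qed
      ultimately have "cycle T ?c" unfolding cycle_def by simp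
      then show ?thesis using assms unfolding tree_def by blast
    qed
  qed
qed (simp add: path_def)

lemma path_infix: "path G (p @ q @ p') \<Longrightarrow> q \<noteq> [] \<Longrightarrow> path G q"
  by (auto simp: path_def successively_append_iff)

section \<open>Rooted trees through their root paths\<close>

locale rooted_tree =
  fixes T :: "'a graph" and r :: 'a
  assumes tree: "tree T" and root: "r \<in> verts T"
begin

text \<open>Replacing a vertex by its path from the root turns the tree order into the prefix order
  on lists, heights into lengths, and a child \<open>y\<close> of \<open>x\<close> into
  \<open>rpath y = rpath x @ [y]\<close>.\<close>

definition rpath :: "'a \<Rightarrow> 'a list" where
  "rpath x = (THE p. path T p \<and> hd p = r \<and> last p = x)"

lemma rpath_eq:
  assumes "path T p" "hd p = r"
  shows "rpath (last p) = p"
  unfolding rpath_def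
proof (rule the_equality)
  show "q = p" if "path T q \<and> hd q = r \<and> last q = last p" for q
    using that assms tree_path_unique[OF tree, of q p] by simp
qed (use assms in simp)

lemma rpath:
  assumes "x \<in> verts T"
  shows "path T (rpath x)" "hd (rpath x) = r" "last (rpath x) = x" "rpath x \<noteq> []"
proof -
  obtain p where p: "path T p" "hd p = r" "last p = x"
    using tree root assms unfolding tree_def connected_graph_def by blast
  then have "rpath x = p" using rpath_eq by blast
  then show "path T (rpath x)" "hd (rpath x) = r" "last (rpath x) = x" "rpath x \<noteq> []"
    using p by (auto simp: path_def)
qed

lemma rpath_prefix:
  assumes "y \<in> verts T" "rpath y = p @ x # q"
  shows "rpath x = p @ [x]" "x \<in> verts T"
proof -
  have "path T (p @ [x])" "hd (p @ [x]) = r"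
    using rpath[OF assms(1)] assms(2)
    by (auto simp: path_def successively_append_iff hd_append split: if_splits)
  then show "rpath x = p @ [x]" "x \<in> verts T" using rpath_eq[of "p @ [x]"] by (auto simp: path_def)
qed

lemma mem_rpath_iff:
  assumes "x \<in> verts T" "y \<in> verts T"
  shows "x \<in> set (rpath y) \<longleftrightarrow> prefix (rpath x) (rpath y)"
proof
  assume "x \<in> set (rpath y)"
  then obtain p q where "rpath y = p @ x # q" by (meson split_list)
  then show "prefix (rpath x) (rpath y)" using rpath_prefix(1)[OF assms(2)] by simp
next
  assume "prefix (rpath x) (rpath y)"
  then show "x \<in> set (rpath y)"
    using rpath[OF assms(1)] last_in_set set_mono_prefix by (metis subsetD)
qed

lemma tree_le_iff:
  assumes "y \<in> verts T"
  shows "tree_le T r x y \<longleftrightarrow> x \<in> set (rpath y)"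
proof
  assume "tree_le T r x y"
  then obtain p where "path T p" "hd p = r" "last p = y" "x \<in> set p" by (auto simp: tree_le_def)
  then show "x \<in> set (rpath y)" using rpath_eq[of p] by simp
qed (use rpath[OF assms] in \<open>auto simp: tree_le_def\<close>)

lemma rpath_inj:
  assumes "x \<in> verts T" "y \<in> verts T" "rpath x = rpath y"
  shows "x = y"
proof -
  have "x = last (rpath x)" using rpath(3)[OF assms(1)] by (rule sym)
  also have "\<dots> = y" unfolding assms(3) by (rule rpath(3)[OF assms(2)])
  finally show ?thesis .
qed

lemma edge_verts:
  assumes "{x, y} \<in> edges T"
  shows "x \<in> verts T" "y \<in> verts T" "x \<noteq> y"
proof -
  obtain u v where "u \<in> verts T" "v \<in> verts T" "u \<noteq> v" "{x, y} = {u, v}"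
    using assms tree unfolding tree_def simple_graph_def by blast
  then show "x \<in> verts T" "y \<in> verts T" "x \<noteq> y" by (auto simp: doubleton_eq_iff)
qed

lemma rpath_extend:
  assumes "{x, y} \<in> edges T" "y \<notin> set (rpath x)"
  shows "rpath y = rpath x @ [y]"
proof -
  note e = edge_verts[OF assms(1)]
  have "path T (rpath x @ [y])" "hd (rpath x @ [y]) = r"
    using rpath[OF e(1)] e(2) assms by (auto simp: path_def successively_append_iff)
  then show ?thesis using rpath_eq[of "rpath x @ [y]"] by simp
qed

lemma rpath_edge:
  assumes "{x, y} \<in> edges T"
  shows "rpath y = rpath x @ [y] \<or> rpath x = rpath y @ [x]"
proof (cases "y \<in> set (rpath x)")
  case True
  note e = edge_verts[OF assms]
  have "x \<notin> set (rpath y)"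
    using True mem_rpath_iff[OF e(1,2)] mem_rpath_iff[OF e(2,1)] rpath_inj[OF e(1,2)] e(3)
    by (auto dest: prefix_order.antisym)
  then show ?thesis using rpath_extend[of y x] assms by (simp add: insert_commute)
qed (use rpath_extend assms in simp)

lemma rpath_last_edge:
  assumes "y \<in> verts T" "rpath y = p @ [x, y]"
  shows "{x, y} \<in> edges T" "rpath x = p @ [x]"
proof -
  show "{x, y} \<in> edges T"
    using rpath(1)[OF assms(1)] assms(2) by (simp add: path_def successively_append_iff)
  show "rpath x = p @ [x]" using rpath_prefix(1)[OF assms(1), of p x "[y]"] assms by simp
qed

lemma rpath_chain_ray:
  assumes "\<And>i::nat. f i \<in> verts T" "\<And>i. rpath (f (Suc i)) = rpath (f i) @ [f (Suc i)]"
  shows "ray T f"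
proof -
  have len: "length (rpath (f i)) = length (rpath (f 0)) + i" for i
    by (induction i) (simp_all add: assms(2))
  have "inj f" by (rule injI) (metis len add_left_cancel)
  moreover have "{f i, f (Suc i)} \<in> edges T" for i
  proof (rule rpath_last_edge(1)[OF assms(1)])
    show "rpath (f (Suc i)) = butlast (rpath (f i)) @ [f i, f (Suc i)]"
      using rpath[OF assms(1), of i] assms(2)[of i] append_butlast_last_id[of "rpath (f i)"] by simp
  qed
  ultimately show ?thesis using assms(1) by (auto simp: ray_def)
qed

lemma rpath_branch:
  assumes "s \<in> verts T" "rpath s = p @ y # q" "z \<in> set (y # q)"
  shows "prefix (p @ [y]) (rpath z)" "z \<in> verts T"
proof -
  obtain q1 q2 where q: "y # q = q1 @ z # q2" using assms(3) by (meson split_list)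
  then have "rpath s = (p @ q1) @ z # q2" using assms(2) by simp
  from rpath_prefix[OF assms(1) this] have z: "rpath z = p @ q1 @ [z]" "z \<in> verts T" by auto
  show "z \<in> verts T" by fact
  show "prefix (p @ [y]) (rpath z)" using q z(1) by (cases q1) auto
qed

lemma rpath_snoc: "x \<in> verts T \<Longrightarrow> rpath x = butlast (rpath x) @ [x]"
  using rpath(3,4)[of x] append_butlast_last_id[of "rpath x"] by simp

lemma rpath_distinct: "x \<in> verts T \<Longrightarrow> distinct (rpath x)"
  using rpath(1) by (simp add: path_def)

text \<open>Raylessness as an induction principle from children to parents; the recursion along the
  decomposition tree rests on it.\<close>

lemma wf_child:
  assumes "rayless T"
  shows "wf {(y, x). x \<in> verts T \<and> y \<in> verts T \<and> rpath y = rpath x @ [y]}"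
  unfolding wf_iff_no_infinite_down_chain
proof (rule notI, elim exE)
  fix f assume f: "\<forall>i. (f (Suc i), f i) \<in> {(y, x). x \<in> verts T \<and> y \<in> verts T \<and> rpath y = rpath x @ [y]}"
  have "ray T f" by (rule rpath_chain_ray) (use f in auto)
  then show False using assms by (auto simp: rayless_def)
qed

text \<open>A Koenig argument. If every vertex had only finitely many children leading to
  \<open>R\<close>, well-founded induction would show that only finitely many \<open>R n\<close> lie
  above any vertex, yet all of them lie above the root.\<close>

lemma infinite_branching:
  assumes rl: "rayless T" and R: "inj R" "\<And>n::nat. R n \<in> verts T"
  shows "\<exists>x\<in>verts T. infinite {y \<in> verts T. rpath y = rpath x @ [y] \<and> (\<exists>n. y \<in> set (rpath (R n)))}"
proof (rule ccontr)
  define ch where "ch x = {y \<in> verts T. rpath y = rpath x @ [y] \<and> (\<exists>n. y \<in> set (rpath (R n)))}" for x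
  assume "\<not> ?thesis"
  then have fin: "finite (ch x)" if "x \<in> verts T" for x using that unfolding ch_def by blast
  define good where "good x \<longleftrightarrow> x \<in> verts T \<and> infinite {n. x \<in> set (rpath (R n))}" for x
  have "\<not> good x" for x
  proof (induction x rule: wf_induct_rule[OF wf_child[OF rl]])
    case (1 x)
    show ?case
    proof
      assume x: "good x"
      then have xT: "x \<in> verts T" by (simp add: good_def)
      have "finite {n. y \<in> set (rpath (R n))}" if "y \<in> ch x" for y
        using 1[of y] that xT unfolding good_def ch_def by blast
      then have "finite (\<Union>y\<in>ch x. {n. y \<in> set (rpath (R n))})" using fin[OF xT] by blast
      moreover have "finite {n. R n = x}" using finite_vimageI[OF _ R(1), of "{x}"] by (simp add: vimage_def)
      moreover have "{n. x \<in> set (rpath (R n))} \<subseteq> {n. R n = x} \<union> (\<Union>y\<in>ch x. {n. y \<in> set (rpath (R n))})"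
      proof
        fix n assume "n \<in> {n. x \<in> set (rpath (R n))}"
        then have "prefix (rpath x) (rpath (R n))" using mem_rpath_iff[OF xT R(2)] by simp
        then obtain q where q: "rpath (R n) = rpath x @ q" by (auto simp: prefix_def)
        show "n \<in> {n. R n = x} \<union> (\<Union>y\<in>ch x. {n. y \<in> set (rpath (R n))})"
        proof (cases q)
          case Nil
          then show ?thesis using q rpath_inj[OF R(2) xT] by simp
        next
          case (Cons y q')
          then have "rpath y = rpath x @ [y]" "y \<in> verts T"
            using rpath_prefix[OF R(2), of n "rpath x" y q'] q by auto
          moreover have yn: "y \<in> set (rpath (R n))" using q Cons by simp
          ultimately have "y \<in> ch x" unfolding ch_def by blast
          then show ?thesis using yn by blast
        qed
      qed
      ultimately show False using x unfolding good_def by (meson finite_UnI finite_subset)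
    qed
  qed
  moreover have "good r"
  proof -
    have "r \<in> set (rpath (R n))" for n
      using rpath(2,4)[OF R(2)] hd_in_set by metis
    then show ?thesis using root by (simp add: good_def)
  qed
  ultimately show False by blast
qed

text \<open>The star alternative of the star-comb lemma: each of infinitely many children of
  \<open>x\<close> leads to a vertex of \<open>R\<close>, and paths through different children share
  only \<open>x\<close>.\<close>

lemma rayless_fan:
  assumes rl: "rayless T" and R: "inj R" "\<And>n::nat. R n \<in> verts T"
  shows "\<exists>x\<in>verts T. \<exists>P. infinite P \<and> fan T x (range R - {x}) P"
proof -
  obtain x where x: "x \<in> verts T"
    and "infinite {y \<in> verts T. rpath y = rpath x @ [y] \<and> (\<exists>n. y \<in> set (rpath (R n)))}"
    using infinite_branching[OF rl R] by blast
  moreover define Y where "Y = {y \<in> verts T. rpath y = rpath x @ [y] \<and> (\<exists>n. y \<in> set (rpath (R n)))}"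
  ultimately have inf: "infinite Y" by simp
  let ?B = "range R - {x}"
  \<comment> \<open>The prefix condition keeps \<open>q\<close> in the subtree above
    \<open>y\<close>; subtrees above distinct children of \<open>x\<close> are disjoint.\<close>
  define branch where "branch y q \<longleftrightarrow> path_between T {x} ?B (x # q) \<and> hd q = y \<and>
    (\<forall>z\<in>set q. prefix (rpath y) (rpath z))" for y q
  have "\<exists>q. branch y q" if y: "y \<in> Y" for y
  proof -
    obtain n where n: "y \<in> set (rpath (R n))" and ry: "rpath y = rpath x @ [y]" "y \<in> verts T" using y unfolding Y_def by blast
    then have "prefix (rpath y) (rpath (R n))" using mem_rpath_iff[OF ry(2) R(2)] by simp
    then obtain q where q: "rpath (R n) = rpath x @ y # q" using ry by (auto simp: prefix_def)
    have xnq: "x \<notin> set (y # q)"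
    proof -
      have "x \<in> set (rpath x)" using rpath(3,4)[OF x] last_in_set by metis
      then show ?thesis using rpath_distinct[OF R(2), of n] unfolding q distinct_append by blast
    qed
    have "last (y # q) = R n" using rpath(3)[OF R(2), of n] q by simp
    then have Rn: "R n \<in> set (y # q)" by (metis last_in_set list.distinct(1))
    then have "R n \<noteq> x" using xnq by metis
    then have "R n \<in> ?B" by simp
    then have "\<exists>b\<in>set (y # q). b \<in> ?B" using Rn by (rule bexI)
    \<comment> \<open>Stopping at the first vertex of \<open>?B\<close> makes the path meet
      \<open>?B\<close> only in its last vertex.\<close>
    then have "\<exists>q1 b q2. y # q = q1 @ b # q2 \<and> b \<in> ?B \<and> (\<forall>z\<in>set q1. z \<notin> ?B)"
      by (rule split_list_first_prop)
    then obtain q1 b q2 where b: "y # q = q1 @ b # q2" "b \<in> ?B" "\<forall>z\<in>set q1. z \<notin> ?B" by metis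
    have "rpath (R n) = butlast (rpath x) @ (x # q1 @ [b]) @ q2"
      using q b(1) rpath_snoc[OF x] by simp
    then have "path T (x # q1 @ [b])"
      using rpath(1)[OF R(2), of n] path_infix[of T "butlast (rpath x)" "x # q1 @ [b]" q2] by simp
    moreover have "x \<notin> set q1" "b \<noteq> x" using xnq b by auto
    ultimately have "path_between T {x} ?B (x # q1 @ [b])"
      using b by (auto simp: path_between_def)
    moreover have "hd (q1 @ [b]) = y" using b(1) by (cases q1) auto
    moreover have "prefix (rpath y) (rpath z)" if "z \<in> set (q1 @ [b])" for z
    proof -
      have "set (q1 @ [b]) \<subseteq> set (y # q)" unfolding b(1) by auto
      then have "z \<in> set (y # q)" using that by blast
      then show ?thesis using rpath_branch(1)[OF R(2) q] ry by simp
    qed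
    ultimately have "branch y (q1 @ [b])" unfolding branch_def by blast
    then show ?thesis ..
  qed
  then obtain g where "\<And>y. y \<in> Y \<Longrightarrow> branch y (g y)" by metis
  then have g: "\<And>y. y \<in> Y \<Longrightarrow> path_between T {x} ?B (x # g y)"
    "\<And>y. y \<in> Y \<Longrightarrow> hd (g y) = y" "\<And>y z. y \<in> Y \<Longrightarrow> z \<in> set (g y) \<Longrightarrow> prefix (rpath y) (rpath z)"
    unfolding branch_def by auto
  let ?P = "(\<lambda>y. x # g y) ` Y"
  have "inj_on (\<lambda>y. x # g y) Y"
    by (rule inj_onI) (metis g(2) list.inject)
  then have "infinite ?P" using inf finite_imageD by blast
  moreover have "set (x # g y) \<inter> set (x # g y') = {x}" if yy: "y \<in> Y" "y' \<in> Y" "y \<noteq> y'" for y y'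
  proof -
    have "set (g y) \<inter> set (g y') = {}"
    proof (rule ccontr)
      assume "\<not> ?thesis"
      then obtain z where "z \<in> set (g y)" "z \<in> set (g y')" by blast
      then have "prefix (rpath y) (rpath z)" "prefix (rpath y') (rpath z)" using g(3) yy by blast+
      then have "prefix (rpath y) (rpath y') \<or> prefix (rpath y') (rpath y)" using prefix_same_cases by blast
      then show False using yy unfolding Y_def by auto
    qed
    moreover have "x \<notin> set (g u)" if "u \<in> Y" for u
      using g(1)[OF that] by (auto simp: path_between_def path_def)
    ultimately show ?thesis using yy by auto
  qed
  then have "fan T x ?B ?P" unfolding fan_def using g(1) by blast
  ultimately show ?thesis using x by blast
qed

end

section \<open>Graphs of the statement as instances of \<open>ugraph\<close>; separation by normal
  trees\<close>

locale sgraph =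
  fixes G :: "'a graph"
  assumes simple: "simple_graph G"
begin

lemma edge_in_verts: "{x, y} \<in> edges G \<Longrightarrow> x \<in> verts G"
proof -
  assume "{x, y} \<in> edges G"
  then obtain u v where "u \<in> verts G" "v \<in> verts G" "{x, y} = {u, v}"
    using simple unfolding simple_graph_def by blast
  then show ?thesis by (auto simp: doubleton_eq_iff)
qed

sublocale ugraph "verts G" "\<lambda>x y. {x, y} \<in> edges G"
proof
  show "{x, y} \<in> edges G \<Longrightarrow> {y, x} \<in> edges G" for x y by (simp add: insert_commute)
qed (rule edge_in_verts)

text \<open>The basic separation property of normal trees. The path is cut at its next vertex
  \<open>y\<close> in \<open>N\<close>, and the induction hypothesis is applied to the
  remainder.\<close>

lemma normal_tree_common_lower_bound:
  assumes N: "normal_tree G N r"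
  shows "path G p \<Longrightarrow> hd p \<in> verts N \<Longrightarrow> last p \<in> verts N \<Longrightarrow>
    \<exists>c\<in>set p \<inter> verts N. prefix (rooted_tree.rpath N r c) (rooted_tree.rpath N r (hd p)) \<and>
      prefix (rooted_tree.rpath N r c) (rooted_tree.rpath N r (last p))"
proof (induction p rule: length_induct)
  case (1 p)
  interpret N: rooted_tree N r using N by unfold_locales (auto simp: normal_tree_def)
  obtain a p' where p: "p = a # p'" using 1 by (cases p) (auto simp: path_def)
  show ?case
  proof (cases "p' = []")
    case True
    then show ?thesis using p 1 by simp
  next
    case False
    then have "last p' \<in> verts N" using 1 p by simp
    then obtain p1 y p2 where p': "p' = p1 @ y # p2" "y \<in> verts N" "\<forall>z\<in>set p1. z \<notin> verts N"
      using split_list_first_prop[of p' "\<lambda>y. y \<in> verts N"] False last_in_set by metis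
    have aN: "a \<in> verts N" using 1 p by simp
    let ?s = "a # p1 @ [y]"
    have s: "path G ?s" "path G (y # p2)"
      using 1 p p' by (auto simp: path_def successively_Cons successively_append_iff hd_append)
    \<comment> \<open>Successive visits to \<open>N\<close> are comparable: either \<open>a\<close>
      and \<open>y\<close> span an edge of \<open>N\<close>, or \<open>?s\<close> is an
      \<open>H_path\<close> and normality applies.\<close>
    have comp: "prefix (N.rpath a) (N.rpath y) \<or> prefix (N.rpath y) (N.rpath a)"
    proof (cases "p1 = [] \<and> {a, y} \<in> edges N")
      case True
      then show ?thesis using N.rpath_edge[of a y] by auto
    next
      case False
      have "path_edges ?s \<inter> edges N = {}"
      proof (cases "p1 = []")
        case True
        then have "path_edges ?s = {{a, y}}" by (auto simp: path_edges_def)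
        then show ?thesis using True False by simp
      next
        case p1: False
        have "{?s ! i, ?s ! Suc i} \<notin> edges N" if i: "Suc i < length ?s" for i
        proof
          assume "{?s ! i, ?s ! Suc i} \<in> edges N"
          then have e: "?s ! i \<in> verts N" "?s ! Suc i \<in> verts N" using N.edge_verts by blast+
          show False
          proof (cases "Suc i < Suc (length p1)")
            case True
            then have "?s ! Suc i \<in> set p1" by (simp add: nth_append)
            then show False using e p'(3) by blast
          next
            case False
            then have "i = length p1" using i by simp
            then have "?s ! i \<in> set p1" using p1 by (cases i) (auto simp: nth_append)
            then show False using e p'(3) by blast
          qed
        qed
        then show ?thesis unfolding path_edges_def by blast
      qed
      then have "H_path G N ?s"
        using s aN p' unfolding H_path_def by auto
      then have "tree_le N r a y \<or> tree_le N r y a"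
        using N unfolding normal_tree_def by fastforce
      then show ?thesis using N.tree_le_iff N.mem_rpath_iff aN p'(2) by simp
    qed
    have "length (y # p2) < length p" using p p' by simp
    then obtain c where c: "c \<in> set (y # p2) \<inter> verts N" "prefix (N.rpath c) (N.rpath y)"
      "prefix (N.rpath c) (N.rpath (last p))"
      using 1(1)[rule_format, of "y # p2"] 1(4) s(2) p p' by auto
    have cp: "c \<in> set p" using c p p' by auto
    show ?thesis
    \<comment> \<open>If \<open>c\<close> is not below \<open>a\<close>, then both are below
      \<open>y\<close>, so \<open>a\<close> is below \<open>c\<close> and is itself a common lower
      bound.\<close>
    proof (cases "prefix (N.rpath c) (N.rpath a)")
      case True
      then show ?thesis using c cp p by auto
    next
      case False
      then have "prefix (N.rpath a) (N.rpath y)" using comp c prefix_order.trans by blast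
      then have "prefix (N.rpath a) (N.rpath c)" using c(2) False prefix_same_cases by blast
      then have "prefix (N.rpath a) (N.rpath (last p))" using c(3) prefix_order.trans by blast
      then show ?thesis using aN p by auto
    qed
  qed
qed

text \<open>Take \<open>a\<close> of least height. A path in \<open>W\<close> from \<open>a\<close>
  to \<open>b\<close> contains a common lower bound of both, which cannot be lower than
  \<open>a\<close> and hence equals it.\<close>

lemma normal_tree_least:
  assumes N: "normal_tree G N r" and W: "conn W" "W \<subseteq> verts G" and x: "x \<in> W" "x \<in> verts N"
  shows "\<exists>a\<in>W \<inter> verts N. \<forall>b\<in>W \<inter> verts N. prefix (rooted_tree.rpath N r a) (rooted_tree.rpath N r b)"
proof -
  interpret N: rooted_tree N r using N by unfold_locales (auto simp: normal_tree_def)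
  obtain a where a: "a \<in> W \<inter> verts N" "\<forall>b. b \<in> W \<inter> verts N \<longrightarrow> length (N.rpath a) \<le> length (N.rpath b)"
    using arg_min_nat_lemma[of "\<lambda>z. z \<in> W \<inter> verts N" x "\<lambda>z. length (N.rpath z)"] x by blast
  have "prefix (N.rpath a) (N.rpath b)" if b: "b \<in> W \<inter> verts N" for b
  proof -
    have "reach W a b" using W(1) a b by (simp add: conn_def)
    then obtain p where "p \<noteq> []" "distinct p" "set p \<subseteq> W" "successively (\<lambda>u v. {u, v} \<in> edges G) p"
      "hd p = a" "last p = b"
      using reach_list a by blast
    then obtain c where c: "c \<in> W \<inter> verts N" "prefix (N.rpath c) (N.rpath a)" "prefix (N.rpath c) (N.rpath b)"
      using normal_tree_common_lower_bound[OF N, of p] W(2) a b by (auto simp: path_def)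
    then have "length (N.rpath a) \<le> length (N.rpath c)" using a(2) by blast
    with c(2) have "N.rpath c = N.rpath a" by (auto simp: prefix_def)
    then show ?thesis using c by simp
  qed
  then show ?thesis using a by blast
qed

text \<open>The least element of \<open>\<Union>i\<ge>m. F i\<close> in the tree order has bounded height and can only go up
  as \<open>m\<close> grows, so it is eventually constant, although the sets \<open>F i\<close> are disjoint.\<close>

lemma normal_tree_level_tame:
  assumes N: "normal_tree G N r"
  shows "tame {x \<in> verts N. length (rooted_tree.rpath N r x) \<le> k}"
  unfolding tame_def
proof (intro notI, elim exE conjE)
  interpret N: rooted_tree N r using N by unfold_locales (auto simp: normal_tree_def)
  fix F :: "nat \<Rightarrow> 'a set"
  let ?U = "{x \<in> verts N. length (N.rpath x) \<le> k}"
  assume F: "\<forall>m. conn (F m) \<and> F m \<subseteq> verts G \<and> F m \<inter> ?U \<noteq> {} \<and> (\<exists>x\<in>F m. \<exists>y\<in>F (Suc m). {x, y} \<in> edges G)"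
    and disj: "\<forall>m n. m \<noteq> n \<longrightarrow> F m \<inter> F n = {}"
  define W where "W m = (\<Union>i\<in>{m..}. F i)" for m
  define h where "h x = length (N.rpath x)" for x
  have W: "conn (W m)" "W m \<subseteq> verts G" for m
    unfolding W_def using F by (auto intro!: conn_chain_union)
  have "\<exists>a. a \<in> W m \<inter> verts N \<and> h a \<le> k \<and> (\<forall>b\<in>W m \<inter> verts N. prefix (N.rpath a) (N.rpath b))" for m
  proof -
    obtain x where x: "x \<in> F m" "x \<in> verts N" "h x \<le> k" using F unfolding h_def by blast
    then have xW: "x \<in> W m" unfolding W_def by auto
    then obtain a where a: "a \<in> W m \<inter> verts N" "\<forall>b\<in>W m \<inter> verts N. prefix (N.rpath a) (N.rpath b)"
      using normal_tree_least[OF N W xW x(2)] by blast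
    then have "h a \<le> h x" using xW x unfolding h_def by (simp add: prefix_length_le)
    then show ?thesis using a x(3) by fastforce
  qed
  then obtain a where a: "\<And>m. a m \<in> W m \<inter> verts N" "\<And>m. h (a m) \<le> k"
    "\<And>m b. b \<in> W m \<inter> verts N \<Longrightarrow> prefix (N.rpath (a m)) (N.rpath b)" by metis
  have "\<exists>M. \<forall>m. h (a m) \<le> h (a M)"
    using ex_has_greatest_nat[of "\<lambda>_. True" 0 "\<lambda>m. h (a m)" "Suc k"] a(2) by (auto simp: less_Suc_eq_le)
  then obtain M where M: "\<And>m. h (a m) \<le> h (a M)" by blast
  obtain j where j: "j \<ge> M" "a M \<in> F j" using a(1)[of M] unfolding W_def by auto
  have "a (Suc j) \<in> W M \<inter> verts N" using a(1)[of "Suc j"] j unfolding W_def by force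
  then have "prefix (N.rpath (a M)) (N.rpath (a (Suc j)))" by (rule a(3))
  then have "N.rpath (a M) = N.rpath (a (Suc j))"
    using M[of "Suc j"] unfolding h_def prefix_def by auto
  then have "a M = a (Suc j)" using a(1) N.rpath_inj by blast
  then obtain i where "i \<ge> Suc j" "a M \<in> F i" using a(1)[of "Suc j"] unfolding W_def by auto
  then show False using j disj by (metis IntI empty_iff not_less_eq_eq order_refl)
qed

end

lemma connected_path:
  assumes "connected_graph D" "u \<in> verts D" "v \<in> verts D"
  obtains p where "path D p" "hd p = u" "last p = v"
proof -
  have "\<forall>u\<in>verts D. \<forall>v\<in>verts D. \<exists>p. path D p \<and> hd p = u \<and> last p = v"
    using assms(1) unfolding connected_graph_def by (rule conjunct2)
  from bspec[OF bspec[OF this assms(2)] assms(3)] show ?thesis using that by (elim exE conjE)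
qed

section \<open>Rayless spanning trees and dominated ends\<close>

context sgraph
begin

lemma edge_distinct: "{x, y} \<in> edges G \<Longrightarrow> x \<noteq> y"
  using simple unfolding simple_graph_def by fastforce

lemma conn_iff_connected: "connected_graph G \<longleftrightarrow> verts G \<noteq> {} \<and> conn (verts G)"
proof -
  have *: "(\<exists>p. path G p \<and> hd p = u \<and> last p = v) \<longleftrightarrow> reach (verts G) u v" if "u \<in> verts G" for u v
  proof
    assume "reach (verts G) u v"
    from reach_list[OF this that] show "\<exists>p. path G p \<and> hd p = u \<and> last p = v"
      unfolding path_def by blast
  next
    assume "\<exists>p. path G p \<and> hd p = u \<and> last p = v"
    then obtain p where p: "path G p" "hd p = u" "last p = v" by blast
    then show "reach (verts G) u v" using list_reach[of p "verts G"] by (simp add: path_def)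
  qed
  have "(\<forall>u\<in>verts G. \<forall>v\<in>verts G. \<exists>p. path G p \<and> hd p = u \<and> last p = v) \<longleftrightarrow> conn (verts G)"
    unfolding conn_def by (rule ball_cong[OF refl], rule ball_cong[OF refl], rule *)
  then show ?thesis by (simp only: connected_graph_def)
qed

lemma nbhd_closed:
  assumes "reach (verts G - nbhd C) x y" "x \<in> C"
  shows "y \<in> C"
  using assms by (rule reach_closed) (auto simp: nbhd_def)

text \<open>The absence of infinite parent chains gives connectedness, that of infinite child chains
  gives acyclicity, and together they exclude rays.\<close>

lemma rforest_spanning_tree:
  assumes rf: "rforest {x0} (verts G - {x0}) p" and x0: "x0 \<in> verts G"
  shows "\<exists>S. spanning_tree G S \<and> rayless S"
proof -
  let ?B = "verts G - {x0}"
  define S where "S = \<lparr>verts = verts G, edges = {{x, p x} | x. x \<in> ?B}\<rparr>"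
  have pV: "p x \<in> verts G" "{x, p x} \<in> edges G" if "x \<in> ?B" for x
    using rforestD(2,3)[OF rf that] x0 by auto
  have edge: "{u, v} \<in> edges S \<longleftrightarrow> (u \<in> ?B \<and> p u = v) \<or> (v \<in> ?B \<and> p v = u)" for u v
    unfolding S_def by (auto simp: doubleton_eq_iff)
  have vS: "verts S = verts G" by (simp add: S_def)
  have sS: "simple_graph S"
    unfolding simple_graph_def
  proof
    fix e assume "e \<in> edges S"
    then obtain x where x: "x \<in> ?B" "e = {x, p x}" by (auto simp: S_def)
    then show "\<exists>u v. u \<in> verts S \<and> v \<in> verts S \<and> u \<noteq> v \<and> e = {u, v}"
      using pV[OF x(1)] edge_distinct vS by auto
  qed
  interpret S: sgraph S by unfold_locales (rule sS)
  have "subgraph S G" unfolding subgraph_def using sS pV by (auto simp: S_def)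
  have to_root: "S.reach (verts S) x x0" if x: "x \<in> verts G" for x
  proof (rule ccontr)
    assume nr: "\<not> ?thesis"
    have "(p ^^ i) x \<in> ?B \<and> \<not> S.reach (verts S) ((p ^^ i) x) x0" for i
    proof (induction i)
      case 0
      then show ?case using x nr by auto
    next
      case (Suc i)
      let ?y = "(p ^^ i) x"
      have "S.reach (verts S) ?y (p ?y)"
        using Suc pV[of ?y] edge vS by (intro S.reach_edge) auto
      then have "\<not> S.reach (verts S) (p ?y) x0" using Suc S.reach_trans by blast
      then show ?case using pV(1)[of ?y] Suc by auto
    qed
    then show False using rforestD(4)[OF rf, of "\<lambda>i. (p ^^ i) x"] by simp
  qed
  then have "S.conn (verts S)" unfolding S.conn_def vS using S.reach_sym S.reach_trans vS by metis
  then have con: "connected_graph S" using S.conn_iff_connected x0 vS by blast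
  have "\<nexists>c. cycle S c"
  proof (rule notI, elim exE)
    fix c assume c: "cycle S c"
    then have dc: "distinct c" "3 \<le> length c" "successively (\<lambda>u v. {u, v} \<in> edges S) c"
      and cl: "{last c, hd c} \<in> edges S"
      by (auto simp: cycle_def path_def)
    let ?n = "length c"
    have ne: "c \<noteq> []" using dc by auto
    have step: "{c ! i, c ! (Suc i mod ?n)} \<in> edges S" if "i < ?n" for i
    proof (cases "Suc i < ?n")
      case True
      then show ?thesis using dc(3) by (simp add: successively_conv_nth)
    next
      case False
      then have "Suc i = ?n" using that by simp
      then show ?thesis using cl ne by (simp add: last_conv_nth hd_conv_nth flip: \<open>Suc i = ?n\<close>)
    qed
    \<comment> \<open>Otherwise choosing a child on the cycle again and again gives an infinite
      ascending chain. A vertex without a child on the cycle has its parent as both neighbours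
      there, which is impossible.\<close>
    have "\<exists>x\<in>set c. \<forall>y\<in>set c. \<not> (y \<in> ?B \<and> p y = x)"
    proof (rule ccontr)
      assume "\<not> ?thesis"
      then have "\<forall>x\<in>set c. \<exists>y. y \<in> set c \<and> y \<in> ?B \<and> p y = x" by blast
      then obtain ch where ch: "\<And>x. x \<in> set c \<Longrightarrow> ch x \<in> set c \<and> ch x \<in> ?B \<and> p (ch x) = x" by metis
      have "(ch ^^ i) (hd c) \<in> set c" for i by (induction i) (use ne ch in auto)
      then show False using rforestD(5)[OF rf, of "\<lambda>i. (ch ^^ i) (hd c)"] ch by simp
    qed
    then obtain x where x: "x \<in> set c" "\<And>y. y \<in> set c \<Longrightarrow> \<not> (y \<in> ?B \<and> p y = x)" by blast
    obtain i where i: "i < ?n" "c ! i = x" using x(1) by (meson in_set_conv_nth)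
    let ?j = "Suc i mod ?n" and ?k = "(if i = 0 then ?n - 1 else i - 1)"
    have j: "?j < ?n" "?k < ?n" "Suc ?k mod ?n = i" "?j \<noteq> ?k"
      using i dc(2) by (auto simp: mod_Suc)
    have "p x = c ! ?j" using step[OF i(1)] i(2) x(2)[of "c ! ?j"] j(1) edge by auto
    moreover have "p x = c ! ?k"
      using step[OF j(2)] i(2) x(2)[OF nth_mem[OF j(2)]] unfolding j(3) by (auto simp: edge)
    ultimately have "c ! ?j = c ! ?k" by simp
    then have "?j = ?k" by (rule iffD1[OF nth_eq_iff_index_eq[OF dc(1) j(1,2)]])
    then show False using j(4) by contradiction
  qed
  then have "tree S" using sS con by (simp add: tree_def)
  moreover have "rayless S"
    unfolding rayless_def
  proof (rule notI, elim exE)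
    fix R assume R: "ray S R"
    then have e: "(R i \<in> ?B \<and> p (R i) = R (Suc i)) \<or> (R (Suc i) \<in> ?B \<and> p (R (Suc i)) = R i)" for i
      unfolding ray_def edge by blast
    have inj: "inj R" using R by (simp add: ray_def)
    show False
    \<comment> \<open>Once a ray steps from a parent to its child it must go on doing so, since a
      step to the parent would return to the preceding vertex.\<close>
    proof (cases "\<exists>i. R (Suc i) \<in> ?B \<and> p (R (Suc i)) = R i")
      case True
      then obtain i where i: "R (Suc i) \<in> ?B \<and> p (R (Suc i)) = R i" by blast
      have "R (Suc (i + j)) \<in> ?B \<and> p (R (Suc (i + j))) = R (i + j)" for j
      proof (induction j)
        case (Suc j)
        have "R (i + j) \<noteq> R (Suc (Suc (i + j)))" using inj by (simp add: inj_eq)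
        then have "p (R (Suc (i + j))) \<noteq> R (Suc (Suc (i + j)))" using Suc by simp
        then show ?case using e[of "Suc (i + j)"] by auto
      qed (use i in simp)
      then show False using rforestD(5)[OF rf, of "\<lambda>j. R (i + j)"] by simp
    next
      case False
      then have "R i \<in> ?B \<and> R (Suc i) = p (R i)" for i using e[of i] by auto
      then show False using rforestD(4)[OF rf, of R] by blast
    qed
  qed
  ultimately show ?thesis using \<open>subgraph S G\<close> vS unfolding spanning_tree_def by blast
qed

text \<open>Puts a ray into its own class. The main point is that the subgraph induced on a
  reachability class \<open>K\<close> is a maximal connected subgraph, as \<open>component\<close>
  demands.\<close>

lemma ray_equiv_refl:
  assumes R: "ray G R"
  shows "(R, R) \<in> ray_equiv G"
proof -
  have "\<exists>C m. component (delete_verts G X) C \<and> ray C (tail R m)" if X: "finite X" for X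
  proof -
    \<comment> \<open>An injective sequence visits the finite set \<open>X\<close> only finitely
      often.\<close>
    have "finite (R -` X)" using R X by (auto simp: ray_def intro: finite_vimageI)
    then obtain m where m: "\<forall>i\<in>R -` X. i < m" using finite_nat_set_iff_bounded by blast
    then have out: "R (m + i) \<in> verts G - X" for i using R by (force simp: ray_def)
    define K where "K = {z. reach (verts G - X) (R m) z}"
    define C where "C = \<lparr>verts = K, edges = {e \<in> edges G. e \<subseteq> K}\<rparr>"
    have K: "is_comp (verts G - X) K" using comp_of[OF out[of 0]] by (simp add: K_def)
    have tailK: "R (m + i) \<in> K" for i
    proof (induction i)
      case (Suc i)
      then show ?case using K out[of "Suc i"] R unfolding is_comp_def ray_def by (metis add_Suc_right)
    qed (simp add: K_def)
    have sC: "simple_graph C" unfolding simple_graph_def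
    proof
      fix e assume "e \<in> edges C"
      then have e: "e \<in> edges G" "e \<subseteq> K" by (auto simp: C_def)
      then obtain u v where "u \<noteq> v" "e = {u, v}" using simple unfolding simple_graph_def by blast
      then show "\<exists>u v. u \<in> verts C \<and> v \<in> verts C \<and> u \<noteq> v \<and> e = {u, v}" using e by (auto simp: C_def)
    qed
    interpret C: sgraph C by unfold_locales (rule sC)
    have vC: "verts C = K" by (simp add: C_def)
    have reachC: "C.reach (verts C) u v" if "u \<in> K" "v \<in> K" for u v
    proof -
      have "reach K u v" using K that by (simp add: is_comp_def conn_def)
      from reach_list[OF this that(1)] obtain q where q: "q \<noteq> []" "set q \<subseteq> K"
        "successively (\<lambda>u v. {u, v} \<in> edges G) q" "hd q = u" "last q = v"
        by blast
      have "successively (\<lambda>u v. {u, v} \<in> edges C) q"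
        using q(3) by (rule successively_mono) (use q(2) in \<open>auto simp: C_def\<close>)
      then show ?thesis using C.list_reach[of q "verts C"] q by (simp add: C_def)
    qed
    then have "C.conn (verts C)" unfolding C.conn_def vC by blast
    then have "connected_graph C" using tailK[of 0] vC unfolding C.conn_iff_connected by blast
    moreover have "subgraph C (delete_verts G X)"
      using sC K by (auto simp: subgraph_def delete_verts_def C_def is_comp_def)
    moreover have "D = C" if D: "subgraph D (delete_verts G X)" "connected_graph D" "subgraph C D" for D
    proof -
      have DG: "verts D \<subseteq> verts G - X" "edges D \<subseteq> edges G"
        using D(1) by (auto simp: subgraph_def delete_verts_def)
      interpret D: sgraph D by unfold_locales (use D(1) in \<open>simp add: subgraph_def\<close>)
      have "R m \<in> verts D" using D(3) tailK[of 0] by (auto simp: subgraph_def C_def)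
      moreover have "y \<in> K" if Dm: "R m \<in> verts D" and Dy: "y \<in> verts D" for y
      proof -
        obtain q where q: "path D q" "hd q = R m" "last q = y"
          by (rule connected_path[OF D(2) Dm Dy])
        have "successively (\<lambda>u v. {u, v} \<in> edges G) q"
          by (rule successively_mono[of "\<lambda>u v. {u, v} \<in> edges D"]) (use q(1) DG in \<open>auto simp: path_def\<close>)
        then show ?thesis
          using list_reach[of q "verts G - X"] q DG unfolding path_def K_def by auto
      qed
      ultimately have vD: "verts D \<subseteq> K" by blast
      have "e \<subseteq> K" if "e \<in> edges D" for e
        using D.simple that vD unfolding simple_graph_def by fastforce
      then have "edges D \<subseteq> edges C" using DG(2) by (auto simp: C_def)
      then show ?thesis using D(3) vD by (intro graph.equality) (auto simp: subgraph_def C_def)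
    qed
    ultimately have "component (delete_verts G X) C" by (simp add: component_def)
    moreover have "ray C (tail R m)"
    proof -
      have "inj R" using R by (simp add: ray_def)
      then have "inj (tail R m)" by (intro injI) (simp add: tail_def inj_eq)
      moreover have "range (tail R m) \<subseteq> verts C" using tailK vC by (auto simp: tail_def)
      moreover have "{tail R m i, tail R m (Suc i)} \<in> edges C" for i
        using R tailK[of i] tailK[of "Suc i"] by (simp add: ray_def tail_def C_def)
      ultimately show ?thesis by (simp add: ray_def)
    qed
    ultimately show ?thesis by blast
  qed
  then show ?thesis using R unfolding ray_equiv_def by blast
qed

text \<open>Let \<open>w\<close> dominate a ray \<open>R'\<close> equivalent to \<open>R\<close>. As
  \<open>nbhd C\<close> is finite, \<open>R'\<close> has a tail in \<open>C\<close>. Were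
  \<open>w\<close> beyond \<open>nbhd C\<close>, every path of the infinite fan would meet a fixed
  finite set outside \<open>w\<close>, although the paths share only \<open>w\<close>.\<close>

lemma ends_dominated_rays:
  assumes dom: "\<forall>\<omega>\<in>ends G. dominated_end G \<omega>"
  shows dominated_rays
  unfolding dominated_rays_def
proof (intro allI impI)
  fix R :: "nat \<Rightarrow> 'a"
  assume "inj R \<and> (\<forall>i. R i \<in> verts G \<and> {R i, R (Suc i)} \<in> edges G)"
  then have R: "ray G R" by (auto simp: ray_def)
  then have "ray_equiv G `` {R} \<in> ends G" unfolding ends_def by (simp add: quotientI)
  with dom have "dominated_end G (ray_equiv G `` {R})" by (rule bspec)
  then obtain R' w where R': "R' \<in> ray_equiv G `` {R}" and w: "w \<in> verts G" "dominates G w R'"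
    unfolding dominated_end_def by (elim bexE)
  show "\<exists>w\<in>verts G. \<forall>C n. C \<subseteq> verts G \<and> finite (nbhd C) \<and> (\<forall>i\<ge>n. R i \<in> C) \<longrightarrow> w \<in> C \<union> nbhd C"
  proof (intro bexI[OF _ w(1)] allI impI)
    fix C n assume C: "C \<subseteq> verts G \<and> finite (nbhd C) \<and> (\<forall>i\<ge>n. R i \<in> C)"
    let ?X = "nbhd C"
    obtain D m n' where D: "component (delete_verts G ?X) D" "ray D (tail R m)" "ray D (tail R' n')"
    proof -
      have "\<forall>X. finite X \<and> X \<subseteq> verts G \<longrightarrow>
          (\<exists>D m n. component (delete_verts G X) D \<and> ray D (tail R m) \<and> ray D (tail R' n))"
        using R' by (simp add: ray_equiv_def)
      from spec[OF this, of ?X]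
      have "\<exists>D m n. component (delete_verts G ?X) D \<and> ray D (tail R m) \<and> ray D (tail R' n)"
        by (rule mp) (use C nbhd_in in simp)
      then show ?thesis using that by (elim exE conjE)
    qed
    have DG: "verts D \<subseteq> verts G - ?X" "edges D \<subseteq> edges G" "connected_graph D"
      using D(1) by (auto simp: component_def subgraph_def delete_verts_def)
    have DC: "y \<in> C" if Dy: "y \<in> verts D" for y
    proof -
      have "R (m + n) \<in> verts D" using D(2) by (auto simp: ray_def tail_def)
      then obtain q where q: "path D q" "hd q = R (m + n)" "last q = y"
        by (rule connected_path[OF DG(3) _ Dy])
      have "successively (\<lambda>u v. {u, v} \<in> edges G) q"
        by (rule successively_mono[of "\<lambda>u v. {u, v} \<in> edges D"]) (use q(1) DG in \<open>auto simp: path_def\<close>)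
      then have "reach (verts G - ?X) (R (m + n)) y"
        using list_reach[of q "verts G - ?X"] q DG unfolding path_def by auto
      then show ?thesis using nbhd_closed C by (metis le_add2)
    qed
    have tail': "R' i \<in> C" if "i \<ge> n'" for i
    proof -
      have "tail R' n' (i - n') \<in> verts D" using D(3) unfolding ray_def by blast
      then show ?thesis using DC that by (simp add: tail_def)
    qed
    show "w \<in> C \<union> ?X"
    proof (rule ccontr)
      assume wn: "w \<notin> C \<union> ?X"
      \<comment> \<open>A fan path either ends in the part of \<open>R'\<close> before its tail in
        \<open>C\<close>, or must cross \<open>nbhd C\<close>. The vertex \<open>w\<close> may lie
        on \<open>R'\<close> and is therefore removed.\<close>
      let ?Y = "(?X \<union> R' ` {..<n'}) - {w}"
      obtain P where P: "infinite P" "fan G w (range R' - {w}) P" using w(2) unfolding dominates_def by blast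
      have "\<exists>y. y \<in> set q \<inter> ?Y" if "q \<in> P" for q
      proof -
        have q: "path G q" "hd q = w" "last q \<in> range R' - {w}" "q \<noteq> []"
          using P(2) that by (auto simp: fan_def path_between_def path_def)
        obtain i where i: "last q = R' i" using q(3) by blast
        show ?thesis
        proof (cases "i < n'")
          case True
          then have "last q \<in> ?Y" using i q(3) by blast
          then show ?thesis using last_in_set[OF q(4)] by blast
        next
          case False
          have "set q \<inter> ?X \<noteq> {}"
          proof
            assume "set q \<inter> ?X = {}"
            then have "reach (verts G - ?X) w (last q)"
              using list_reach[of q "verts G - ?X"] q by (auto simp: path_def)
            then have "w \<in> C" using nbhd_closed reach_sym tail' i False by (metis not_less)
            then show False using wn by blast
          qed
          then show ?thesis using wn by blast
        qed
      qed
      then obtain g where g: "\<And>q. q \<in> P \<Longrightarrow> g q \<in> set q \<inter> ?Y" by metis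
      have "inj_on g P"
      proof (rule inj_onI, rule ccontr)
        fix q q' assume qq: "q \<in> P" "q' \<in> P" "g q = g q'" "q \<noteq> q'"
        then have "set q \<inter> set q' = {w}" using P(2) by (auto simp: fan_def)
        then show False using g[OF qq(1)] g[OF qq(2)] qq(3) by auto
      qed
      moreover have "g ` P \<subseteq> ?Y" using g by blast
      moreover have "finite ?Y" using C by simp
      ultimately show False using P(1) inj_on_finite by blast
    qed
  qed
qed

lemma rayless_spanning_tree_dominated:
  assumes S: "spanning_tree G S" "rayless S"
  shows "\<forall>\<omega>\<in>ends G. dominated_end G \<omega>"
proof
  fix \<omega> assume "\<omega> \<in> ends G"
  then obtain R where R: "ray G R" "\<omega> = ray_equiv G `` {R}"
    unfolding ends_def by (auto elim: quotientE)
  have RS: "R n \<in> verts S" "inj R" for n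
    using R(1) S(1) by (auto simp: ray_def spanning_tree_def)
  interpret S: rooted_tree S "R 0"
    by unfold_locales (use S RS in \<open>auto simp: spanning_tree_def\<close>)
  obtain x P where x: "x \<in> verts S" "infinite P" "fan S x (range R - {x}) P"
    using S.rayless_fan[OF S(2) RS(2,1)] by blast
  have "path G q" if "path S q" for q
    using that S(1) unfolding path_def spanning_tree_def subgraph_def
    by (auto elim: successively_mono)
  then have "fan G x (range R - {x}) P"
    using x(3) unfolding fan_def path_between_def by blast
  then have "dominates G x R" using x(2) unfolding dominates_def by blast
  moreover have "x \<in> verts G" using x(1) S(1) by (simp add: spanning_tree_def)
  moreover have "R \<in> \<omega>" using ray_equiv_refl[OF R(1)] R(2) by simp
  ultimately show "dominated_end G \<omega>" unfolding dominated_end_def by blast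
qed

end

section \<open>Induction along the decomposition tree\<close>

locale decomposed_graph = sgraph G + D: rooted_tree D r
  for G :: "'a graph" and D :: "'b graph" and r :: 'b +
  fixes part :: "'b \<Rightarrow> 'a set"
  assumes decomposition: "tree_decomposition G D part"
begin

text \<open>The tree path \<open>?w\<close> from \<open>s\<close> down to \<open>t\<close> and up to
  \<open>s'\<close> passes through \<open>t\<close>, so the third axiom of tree-decompositions
  applies.\<close>

lemma separation:
  assumes s: "s \<in> verts D" "D.rpath s = D.rpath t @ t' # q"
    and s': "s' \<in> verts D" "t \<in> set (D.rpath s')" "t' \<notin> set (D.rpath s')" and t: "t \<in> verts D"
  shows "part s \<inter> part s' \<subseteq> part t"
proof -
  have "prefix (D.rpath t) (D.rpath s')" using D.mem_rpath_iff[OF t s'(1)] s'(2) by simp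
  then obtain q' where q': "D.rpath s' = D.rpath t @ q'" by (auto simp: prefix_def)
  obtain a where a: "D.rpath t = a @ [t]" using D.rpath_snoc[OF t] by blast
  let ?w = "rev (t' # q) @ t # q'"
  have ps: "path D (D.rpath s)" "path D (D.rpath s')" by (rule D.rpath(1), fact)+
  have disj: "set (t' # q) \<inter> set q' = {}"
  proof (rule ccontr)
    assume "\<not> ?thesis"
    then obtain z where z: "z \<in> set (t' # q)" "z \<in> set q'" by blast
    have "prefix (D.rpath t @ [t']) (D.rpath z)" and zD: "z \<in> verts D" using D.rpath_branch[OF s z(1)] by auto
    then have "t' \<in> set (D.rpath z)" using set_mono_prefix by fastforce
    moreover have "prefix (D.rpath z) (D.rpath s')" using D.mem_rpath_iff[OF zD s'(1)] z(2) q' by simp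
    ultimately show False using s'(3) set_mono_prefix by blast
  qed
  have "successively (\<lambda>u v. {u, v} \<in> edges D) (rev (t' # q))"
    using ps(1) s(2) by (subst successively_rev) (simp add: path_def successively_append_iff insert_commute)
  moreover have "{t', t} \<in> edges D"
    using ps(1) s(2) a by (simp add: path_def successively_append_iff insert_commute)
  moreover have "successively (\<lambda>u v. {u, v} \<in> edges D) (t # q')"
    using ps(2) q' a by (simp add: path_def successively_append_iff)
  ultimately have "successively (\<lambda>u v. {u, v} \<in> edges D) ?w"
    by (auto simp: successively_append_iff)
  moreover have "distinct ?w" using ps s(2) q' a disj by (auto simp: path_def)
  moreover have "set ?w \<subseteq> verts D" using ps s(2) q' a by (auto simp: path_def)
  ultimately have w: "path D ?w" by (simp add: path_def)
  have "hd ?w = last (D.rpath s)" using s(2) by (simp add: hd_append hd_rev)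
  then have "hd ?w = s" using D.rpath(3)[OF s(1)] by (rule trans)
  moreover have "last ?w = last (D.rpath s')" using q' a by simp
  then have "last ?w = s'" using D.rpath(3)[OF s'(1)] by (rule trans)
  moreover have "part (hd ?w) \<inter> part (last ?w) \<subseteq> part t"
    using decomposition w unfolding tree_decomposition_def by (metis in_set_conv_decomp)
  ultimately show ?thesis by simp
qed

text \<open>A connected set above \<open>t\<close> that avoids \<open>part t\<close> cannot switch
  between children of \<open>t\<close>: two adjacent vertices share a part, and by
  \<open>separation\<close> all parts containing a given vertex outside \<open>part t\<close> lie
  above the same child.\<close>

lemma child_part:
  assumes t: "t \<in> verts D" and C: "conn C" "C \<noteq> {}" "C \<subseteq> verts G" "C \<inter> part t = {}"
    and above: "\<And>x s. x \<in> C \<Longrightarrow> s \<in> verts D \<Longrightarrow> x \<in> part s \<Longrightarrow> t \<in> set (D.rpath s)"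
  obtains t' where "t' \<in> verts D" "D.rpath t' = D.rpath t @ [t']"
    "\<And>x s. x \<in> C \<Longrightarrow> s \<in> verts D \<Longrightarrow> x \<in> part s \<Longrightarrow> t' \<in> set (D.rpath s)"
proof -
  have cover: "\<exists>s\<in>verts D. x \<in> part s" if "x \<in> C" for x
    using decomposition that C(3) unfolding tree_decomposition_def by blast
  obtain x0 s0 where x0: "x0 \<in> C" "s0 \<in> verts D" "x0 \<in> part s0" using C(2) cover by blast
  then have "prefix (D.rpath t) (D.rpath s0)" using above D.mem_rpath_iff[OF t] by simp
  then obtain q0 where q0: "D.rpath s0 = D.rpath t @ q0" by (auto simp: prefix_def)
  have "q0 \<noteq> []" using q0 D.rpath_inj[OF x0(2) t] x0 C(4) by auto
  then obtain t' q where q: "D.rpath s0 = D.rpath t @ t' # q" using q0 by (cases q0) auto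
  have t': "D.rpath t' = D.rpath t @ [t']" "t' \<in> verts D"
    using D.rpath_prefix[OF x0(2) q] by auto
  have same: "t' \<in> set (D.rpath s')"
    if x: "x \<in> C" "s \<in> verts D" "s' \<in> verts D" "x \<in> part s" "x \<in> part s'" "t' \<in> set (D.rpath s)" for x s s'
  proof (rule ccontr)
    assume n: "t' \<notin> set (D.rpath s')"
    have "prefix (D.rpath t') (D.rpath s)" using D.mem_rpath_iff[OF t'(2) x(2)] x(6) by simp
    then obtain q where "D.rpath s = D.rpath t @ t' # q" using t' by (auto simp: prefix_def)
    then have "part s \<inter> part s' \<subseteq> part t" using separation x above n t by blast
    then show False using x C(4) by blast
  qed
  let ?K = "{x. \<forall>s\<in>verts D. x \<in> part s \<longrightarrow> t' \<in> set (D.rpath s)}"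
  have "x0 \<in> ?K" using same[OF x0(1,2)] x0 q by auto
  have "y \<in> ?K" if "y \<in> C" for y
  proof (rule reach_closed[of C x0])
    show "reach C x0 y" using C(1) x0 that by (simp add: conn_def)
    show "v \<in> ?K" if uv: "u \<in> ?K" "u \<in> C" "v \<in> C" "{u, v} \<in> edges G" for u v
    proof -
      obtain s where "s \<in> verts D" "{u, v} \<subseteq> part s"
        using decomposition uv(4) unfolding tree_decomposition_def by blast
      then show ?thesis using uv same[of v s] by auto
    qed
  qed fact
  then show ?thesis using that t' by blast
qed

text \<open>Cover \<open>part t\<close> first; each component of what remains of \<open>C\<close>
  lies above one child of \<open>t\<close> by \<open>child_part\<close>, and the induction
  hypothesis covers it with the enlarged root set.\<close>

lemma rforest_above:
  assumes V: "conn (verts G)" and dom: dominated_rays and rl: "rayless D"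
    and span: "\<And>t. t \<in> verts D \<Longrightarrow> \<exists>U::nat \<Rightarrow> 'a set. mono U \<and> (\<forall>k. U k \<subseteq> verts G \<and> tame (U k)) \<and> (\<Union>k. U k) = part t"
  shows "t \<in> verts D \<Longrightarrow> A \<noteq> {} \<Longrightarrow> A \<subseteq> verts G \<Longrightarrow> conn C \<Longrightarrow> C \<subseteq> verts G \<Longrightarrow> C \<inter> A = {} \<Longrightarrow> nbhd C \<subseteq> A \<Longrightarrow>
    (\<And>x s. x \<in> C \<Longrightarrow> s \<in> verts D \<Longrightarrow> x \<in> part s \<Longrightarrow> t \<in> set (D.rpath s)) \<Longrightarrow> \<exists>p. rforest A C p"
proof (induction t arbitrary: A C rule: wf_induct_rule[OF D.wf_child[OF rl]])
  case (1 t)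
  note t = "1.prems"(1) and A = "1.prems"(2,3) and C = "1.prems"(4-7) and above = "1.prems"(8)
  obtain U :: "nat \<Rightarrow> 'a set" where U: "mono U" "\<And>k. U k \<subseteq> verts G" "\<And>k. tame (U k)" "(\<Union>k. U k) = part t"
    using span[OF t] by blast
  obtain B p where B: "B \<subseteq> verts G" "part t \<subseteq> A \<union> B" "rforest A B p"
    using rforest_covering[OF V A U(1-3) dom] U(4) by auto
  \<comment> \<open>The covering forest may leave \<open>C\<close>, so it is cut down to
    \<open>C\<close>.\<close>
  have rB: "rforest A (B \<inter> C) p" using rforest_Int[OF B(3) C(4)] .
  have "\<exists>q. rforest (A \<union> (B \<inter> C)) (C - B \<inter> C) q"
  proof (rule rforest_components)
    fix C' assume C': "is_comp (C - B \<inter> C) C'"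
    then have C'': "conn C'" "C' \<noteq> {}" "C' \<subseteq> C" "C' \<inter> B = {}" by (auto simp: is_comp_def)
    obtain t' where t': "t' \<in> verts D" "D.rpath t' = D.rpath t @ [t']"
      "\<And>x s. x \<in> C' \<Longrightarrow> s \<in> verts D \<Longrightarrow> x \<in> part s \<Longrightarrow> t' \<in> set (D.rpath s)"
    proof (rule child_part[OF t C''(1,2)])
      show "C' \<subseteq> verts G" using C'' C by blast
      show "C' \<inter> part t = {}" using C'' C B(2) by blast
      show "t \<in> set (D.rpath s)" if "x \<in> C'" "s \<in> verts D" "x \<in> part s" for x s
        using that above C'' by blast
    qed blast
    have nb: "nbhd C' \<subseteq> A \<union> (B \<inter> C)"
    proof
      fix y assume y: "y \<in> nbhd C'"
      then obtain x where x: "x \<in> C'" "{x, y} \<in> edges G" "y \<notin> C'" by (auto simp: nbhd_def)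
      show "y \<in> A \<union> (B \<inter> C)"
      proof (cases "y \<in> C")
        case True
        then show ?thesis using x C' by (auto simp: is_comp_def)
      next
        case False
        then have "y \<in> nbhd C" using x C''(3) by (auto simp: nbhd_def)
        then show ?thesis using C(4) by blast
      qed
    qed
    show "\<exists>q. rforest (A \<union> (B \<inter> C)) C' q"
    proof (rule "1.IH"[of t'])
      show "(t', t) \<in> {(y, x). x \<in> verts D \<and> y \<in> verts D \<and> D.rpath y = D.rpath x @ [y]}" using t t' by simp
    qed (use t' nb A B(1) C C'' in auto)
  qed
  then obtain q where "rforest (A \<union> (B \<inter> C)) (C - B \<inter> C) q" ..
  from rforest_Un[OF rB this] show ?case by (auto simp: Un_absorb1 Int_commute)
qed

end

text \<open>The tame pieces are the vertices of \<open>U\<close> up to height \<open>k\<close> in a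
  normal tree containing \<open>U\<close>.\<close>

lemma normally_spanned_tame:
  assumes "simple_graph G" "normally_spanned G U"
  shows "\<exists>W::nat \<Rightarrow> 'a set. mono W \<and> (\<forall>k. W k \<subseteq> verts G \<and>
    ugraph.tame (verts G) (\<lambda>x y. {x, y} \<in> edges G) (W k)) \<and> (\<Union>k. W k) = (U :: 'a set)"
proof -
  interpret sgraph G by unfold_locales fact
  obtain N r where N: "normal_tree G N r" "U \<subseteq> verts N" using assms(2) unfolding normally_spanned_def by blast
  define W where "W k = {x \<in> U. length (rooted_tree.rpath N r x) \<le> k}" for k
  have "verts N \<subseteq> verts G" using N(1) by (simp add: normal_tree_def subgraph_def)
  then have "W k \<subseteq> verts G" for k using N(2) by (auto simp: W_def)
  moreover have "tame (W k)" for k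
    by (rule tame_subset[OF normal_tree_level_tame[OF N(1), of k]]) (use N(2) in \<open>auto simp: W_def\<close>)
  moreover have "mono W" by (rule monoI) (auto simp: W_def)
  moreover have "(\<Union>k. W k) = U" by (auto simp: W_def)
  ultimately show ?thesis by blast
qed

theorem theorem2:
  fixes G :: "'a graph"
  assumes "simple_graph G"
    and "normally_traceable TYPE('b) G"
  shows "(\<exists>T. spanning_tree G T \<and> rayless T) \<longleftrightarrow> (\<forall>\<omega>\<in>ends G. dominated_end G \<omega>)"
proof
  interpret sgraph G by unfold_locales fact
  show "\<forall>\<omega>\<in>ends G. dominated_end G \<omega>" if "\<exists>T. spanning_tree G T \<and> rayless T"
    using that rayless_spanning_tree_dominated by blast
  assume dom: "\<forall>\<omega>\<in>ends G. dominated_end G \<omega>"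
  have con: "connected_graph G" using assms(2) by (simp add: normally_traceable_def)
  obtain D :: "'b graph" and part where D: "tree_decomposition G D part" "rayless D"
    "\<And>t. t \<in> verts D \<Longrightarrow> normally_spanned G (part t)"
    using assms(2) unfolding normally_traceable_def by blast
  have "tree D" using D(1) by (simp add: tree_decomposition_def)
  then obtain r where r: "r \<in> verts D" unfolding tree_def connected_graph_def by blast
  interpret decomposed_graph G D r part by unfold_locales fact+
  have V: "conn (verts G)" "verts G \<noteq> {}" using con conn_iff_connected by auto
  then obtain x0 where x0: "x0 \<in> verts G" by blast
  \<comment> \<open>An arbitrary vertex \<open>x0\<close> is the root. Every node of
    \<open>D\<close> lies above \<open>r\<close>, so each component of the rest satisfies the
    hypotheses of \<open>rforest_above\<close> at \<open>r\<close>.\<close>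
  have "\<exists>q. rforest {x0} (verts G - {x0}) q"
  proof (rule rforest_components)
    fix C assume C: "is_comp (verts G - {x0}) C"
    show "\<exists>q. rforest {x0} C q"
    proof (rule rforest_above[OF V(1) ends_dominated_rays[OF dom] D(2)])
      show "\<exists>W::nat \<Rightarrow> 'a set. mono W \<and> (\<forall>k. W k \<subseteq> verts G \<and> tame (W k)) \<and> (\<Union>k. W k) = part t"
        if "t \<in> verts D" for t
        using normally_spanned_tame[OF assms(1) D(3)[OF that]] .
      show "nbhd C \<subseteq> {x0}" using comp_nbhd_subset[OF C] .
      show "r \<in> set (D.rpath s)" if "s \<in> verts D" for s
        using D.rpath(2,4)[OF that] hd_in_set by metis
    qed (use C x0 r in \<open>auto simp: is_comp_def\<close>)
  qed
  then show "\<exists>T. spanning_tree G T \<and> rayless T" using rforest_spanning_tree x0 by blast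
qed

end
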